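(* Let $b\in L^\infty(\Omega)$. Then for every $f\in H$, every $x\in G$ and every $y\in Y$, \[ (V_b f)(x,y)=\int_{G\times Y} f(u,v)\,\phi_b(x-u,y,v)\,d\nu(u)\,d\lambda(v). \]
   Context: Let $G$ be a metrizable, $\sigma$-compact locally compact abelian group (written additively) with Haar measure $\nu$, and let $(Y,\lambda)$ be a $\sigma$-finite measure space, with $L^2(G,\nu)$ and $L^2(Y,\lambda)$ separable. Let $H$ be a reproducing kernel Hilbert space of complex functions on $G\times Y$ whose inner product is that of $L^2(G\times Y,\nu\otimes\lambda)$, i.e. $\langle f,g\rangle=\int_{G\times Y}f\,\overline{g}\,d(\nu\otimes\lambda)$, with reproducing kernel $(K_{x,y})_{(x,y)\in G\times Y}$ (so $K_{x,y}\in H$ and $f(x,y)=\langle f,K_{x,y}\rangle$ for $f\in H$). Assume $K_{x,y}(u,v)=K_{0,y}(u-x,v)$ for all $u,x\in G$, $v,y\in Y$, and $\sup_{v\in Y}\int_G|K_{0,y}(u,v)|\,d\nu(u)<\infty$ for every $y\in Y$. Let $\widehat G$ be the dual group with Haar measure $\widehat\nu$ normalized so that the Fourier–Plancherel transform $F\colon L^2(G)\to L^2(\widehat G)$, $(Fh)(\xi)=\int_G h(u)\overline{\xi(u)}\,d\nu(u)$, is unitary. Define $L_{\xi,y}(v)=\int_G K_{0,y}(u,v)\overline{\xi(u)}\,d\nu(u)$ for $\xi\in\widehat G$, $y,v\in Y$, and $\Omega=\{\xi\in\widehat G:\exists y\in Y,\ L_{\xi,y}(y)>0\}$ with the restriction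 of $\widehat\nu$. Assume there is a measurable family $(q_\xi)_{\xi\in\Omega}$ of functions on $Y$ with $L_{\xi,y}(v)=\overline{q_\xi(y)}\,q_\xi(v)$ for all $\xi\in\Omega$, $y,v\in Y$. Define $R\colon H\to L^2(\Omega)$ by $(Rf)(\xi)=\int_Y((F\otimes I)f)(\xi,v)\,\overline{q_\xi(v)}\,d\lambda(v)$, where $F\otimes I$ is the Fourier–Plancherel transform in the first variable; it is known that $R$ is a unitary operator from $H$ onto $L^2(\Omega)$. For $b\in L^\infty(\Omega)$ let $M_b$ be the multiplication operator by $b$ on $L^2(\Omega)$ and $V_b=R^*M_bR\in\mathcal B(H)$. For $b\in L^\infty(\Omega)$ define $\phi_b\colon G\times Y\times Y\to\mathbb C$ by $\phi_b(x,y,v)=\int_\Omega \xi(x)\,L_{\xi,v}(y)\,b(\xi)\,d\widehat\nu(\xi)$ (this integral converges absolutely). *)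

theory Defs
  imports "HOL-Analysis.Analysis"
begin

definition borel_of :: "'a topology \<Rightarrow> 'a measure" where
  "borel_of T = sigma (topspace T) {U. openin T U}"

definition haar_on :: "'a topology \<Rightarrow> ('a \<Rightarrow> 'a \<Rightarrow> 'a) \<Rightarrow> 'a measure \<Rightarrow> bool" where
  "haar_on T gop M \<longleftrightarrow>
     space M = topspace T \<and> sets M = sets (borel_of T) \<and>
     (\<forall>K. compactin T K \<longrightarrow> emeasure M K < \<infinity>) \<and>
     (\<forall>U. openin T U \<and> U \<noteq> {} \<longrightarrow> emeasure M U > 0) \<and>
     (\<forall>A\<in>sets M. emeasure M A = (INF U\<in>{U. openin T U \<and> A \<subseteq> U}. emeasure M U)) \<and>
     (\<forall>U. openin T U \<longrightarrow> emeasure M U = (SUP K\<in>{K. compactin T K \<and> K \<subseteq> U}. emeasure M K)) \<and>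
     (\<forall>a\<in>topspace T. \<forall>A\<in>sets M. emeasure M (gop a ` A) = emeasure M A)"

definition square_integrable :: "'a measure \<Rightarrow> ('a \<Rightarrow> complex) \<Rightarrow> bool" where
  "square_integrable M f \<longleftrightarrow> f \<in> borel_measurable M \<and> integrable M (\<lambda>x. (cmod (f x))\<^sup>2)"

definition L2dist2 :: "'a measure \<Rightarrow> ('a \<Rightarrow> complex) \<Rightarrow> ('a \<Rightarrow> complex) \<Rightarrow> real" where
  "L2dist2 M f g = (\<integral>x. (cmod (f x - g x))\<^sup>2 \<partial>M)"

definition L2_separable :: "'a measure \<Rightarrow> bool" where
  "L2_separable M \<longleftrightarrow> (\<exists>D::('a \<Rightarrow> complex) set. countable D \<and> (\<forall>d\<in>D. square_integrable M d) \<and>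
     (\<forall>f. square_integrable M f \<longrightarrow> (\<forall>e>0. \<exists>d\<in>D. L2dist2 M f d < e)))"

definition essentially_bounded :: "'a measure \<Rightarrow> ('a \<Rightarrow> complex) \<Rightarrow> bool" where
  "essentially_bounded M b \<longleftrightarrow> b \<in> borel_measurable M \<and> (\<exists>C. AE x in M. cmod (b x) \<le> C)"

definition lca_metrizable_sigma_compact :: "'g::{ab_group_add, metric_space} itself \<Rightarrow> bool" where
  "lca_metrizable_sigma_compact _ \<longleftrightarrow>
     continuous_on UNIV (\<lambda>p::'g \<times> 'g. fst p + snd p) \<and>
     continuous_on UNIV (uminus :: 'g \<Rightarrow> 'g) \<and>
     locally compact (UNIV :: 'g set) \<and>
     (\<exists>C :: nat \<Rightarrow> 'g set. (\<forall>n. compact (C n)) \<and> (\<Union>n. C n) = UNIV)"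

definition dual_chars :: "('g::{ab_group_add, topological_space} \<Rightarrow> complex) set" where
  "dual_chars = {\<gamma>. continuous_on UNIV \<gamma> \<and> (\<forall>x y. \<gamma> (x + y) = \<gamma> x * \<gamma> y) \<and> (\<forall>x. cmod (\<gamma> x) = 1)}"

definition dual_topology :: "('g::{ab_group_add, topological_space} \<Rightarrow> complex) topology" where
  "dual_topology = topology_generated_by
     {{\<psi>\<in>dual_chars. \<forall>x\<in>K. cmod (\<psi> x - \<gamma> x) < e} | \<gamma> K e. \<gamma> \<in> dual_chars \<and> compact K \<and> e > 0}"

definition dual_mult :: "('g \<Rightarrow> complex) \<Rightarrow> ('g \<Rightarrow> complex) \<Rightarrow> ('g \<Rightarrow> complex)" where
  "dual_mult \<gamma> \<psi> = (\<lambda>x. \<gamma> x * \<psi> x)"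

definition fourier :: "'g measure \<Rightarrow> ('g \<Rightarrow> complex) \<Rightarrow> ('g \<Rightarrow> complex) \<Rightarrow> complex" where
  "fourier \<nu> h \<xi> = (\<integral>u. h u * cnj (\<xi> u) \<partial>\<nu>)"

text \<open>Normalization of the dual Haar measure: F is isometric on L1 \<inter> L2 (hence extends to
  the unitary Fourier-Plancherel transform).\<close>
definition plancherel_normalized :: "'g measure \<Rightarrow> ('g \<Rightarrow> complex) measure \<Rightarrow> bool" where
  "plancherel_normalized \<nu> \<nu>h \<longleftrightarrow>
     (\<forall>h. integrable \<nu> h \<and> square_integrable \<nu> h \<longrightarrow>
        square_integrable \<nu>h (fourier \<nu> h) \<and>
        (\<integral>\<xi>. (cmod (fourier \<nu> h \<xi>))\<^sup>2 \<partial>\<nu>h) = (\<integral>u. (cmod (h u))\<^sup>2 \<partial>\<nu>))"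

text \<open>Fourier-Plancherel transform on L2: the L2-limit of F h_n for h_n in L1 \<inter> L2 with h_n \<rightarrow> h
  in L2 (well defined up to null sets).\<close>
definition is_FP :: "'g measure \<Rightarrow> ('g \<Rightarrow> complex) measure \<Rightarrow> ('g \<Rightarrow> complex)
                     \<Rightarrow> (('g \<Rightarrow> complex) \<Rightarrow> complex) \<Rightarrow> bool" where
  "is_FP \<nu> \<nu>h h g \<longleftrightarrow> square_integrable \<nu>h g \<and>
     (\<exists>hn :: nat \<Rightarrow> 'g \<Rightarrow> complex. (\<forall>n. integrable \<nu> (hn n) \<and> square_integrable \<nu> (hn n)) \<and>
        (\<lambda>n. L2dist2 \<nu> (hn n) h) \<longlonglongrightarrow> 0 \<and>
        (\<lambda>n. L2dist2 \<nu>h (fourier \<nu> (hn n)) g) \<longlonglongrightarrow> 0)"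

definition is_FI :: "'g measure \<Rightarrow> ('g \<Rightarrow> complex) measure \<Rightarrow> 'y measure
                     \<Rightarrow> ('g \<times> 'y \<Rightarrow> complex) \<Rightarrow> (('g \<Rightarrow> complex) \<times> 'y \<Rightarrow> complex) \<Rightarrow> bool" where
  "is_FI \<nu> \<nu>h lam f \<Phi> \<longleftrightarrow> \<Phi> \<in> borel_measurable (\<nu>h \<Otimes>\<^sub>M lam) \<and>
     (AE v in lam. is_FP \<nu> \<nu>h (\<lambda>u. f (u, v)) (\<lambda>\<xi>. \<Phi> (\<xi>, v)))"

definition FI :: "'g measure \<Rightarrow> ('g \<Rightarrow> complex) measure \<Rightarrow> 'y measure
                  \<Rightarrow> ('g \<times> 'y \<Rightarrow> complex) \<Rightarrow> (('g \<Rightarrow> complex) \<times> 'y \<Rightarrow> complex)" where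
  "FI \<nu> \<nu>h lam f = (SOME \<Phi>. is_FI \<nu> \<nu>h lam f \<Phi>)"

definition Lker :: "'g::ab_group_add measure \<Rightarrow> ('g \<Rightarrow> 'y \<Rightarrow> 'g \<times> 'y \<Rightarrow> complex)
                    \<Rightarrow> ('g \<Rightarrow> complex) \<Rightarrow> 'y \<Rightarrow> 'y \<Rightarrow> complex" where
  "Lker \<nu> K \<xi> y v = (\<integral>u. K 0 y (u, v) * cnj (\<xi> u) \<partial>\<nu>)"

definition Omega :: "'g::{ab_group_add, topological_space} measure \<Rightarrow> ('g \<Rightarrow> 'y \<Rightarrow> 'g \<times> 'y \<Rightarrow> complex)
                     \<Rightarrow> ('g \<Rightarrow> complex) set" where
  "Omega \<nu> K = {\<xi>\<in>dual_chars. \<exists>y. Lker \<nu> K \<xi> y y \<in> \<real> \<and> Re (Lker \<nu> K \<xi> y y) > 0}"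

definition rkhs_L2 :: "'g measure \<Rightarrow> 'y measure \<Rightarrow> ('g \<times> 'y \<Rightarrow> complex) set
                       \<Rightarrow> ('g \<Rightarrow> 'y \<Rightarrow> 'g \<times> 'y \<Rightarrow> complex) \<Rightarrow> bool" where
  "rkhs_L2 \<nu> lam H K \<longleftrightarrow>
     (\<forall>f\<in>H. square_integrable (\<nu> \<Otimes>\<^sub>M lam) f) \<and>
     (\<lambda>_. 0) \<in> H \<and>
     (\<forall>f\<in>H. \<forall>g\<in>H. (\<lambda>p. f p + g p) \<in> H) \<and>
     (\<forall>c. \<forall>f\<in>H. (\<lambda>p. c * f p) \<in> H) \<and>
     (\<forall>s :: nat \<Rightarrow> 'g \<times> 'y \<Rightarrow> complex. (\<forall>n. s n \<in> H) \<and>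
        (\<forall>e>0. \<exists>N. \<forall>m\<ge>N. \<forall>n\<ge>N. L2dist2 (\<nu> \<Otimes>\<^sub>M lam) (s m) (s n) < e) \<longrightarrow>
        (\<exists>f\<in>H. (\<lambda>n. L2dist2 (\<nu> \<Otimes>\<^sub>M lam) (s n) f) \<longlonglongrightarrow> 0)) \<and>
     (\<forall>x y. K x y \<in> H) \<and>
     (\<forall>f\<in>H. \<forall>x y. f (x, y) = (\<integral>p. f p * cnj (K x y p) \<partial>(\<nu> \<Otimes>\<^sub>M lam)))"

definition Rop :: "'g measure \<Rightarrow> ('g \<Rightarrow> complex) measure \<Rightarrow> 'y measure
                   \<Rightarrow> (('g \<Rightarrow> complex) \<Rightarrow> 'y \<Rightarrow> complex) \<Rightarrow> ('g \<times> 'y \<Rightarrow> complex) \<Rightarrow> ('g \<Rightarrow> complex) \<Rightarrow> complex" where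
  "Rop \<nu> \<nu>h lam q f \<xi> = (\<integral>v. FI \<nu> \<nu>h lam f (\<xi>, v) * cnj (q \<xi> v) \<partial>lam)"

text \<open>V_b = R^* M_b R, i.e. V_b f is the element g of H with R g = b \<cdot> R f a.e. on Omega.\<close>
definition Vop :: "'g::{ab_group_add, topological_space} measure \<Rightarrow> ('g \<Rightarrow> complex) measure \<Rightarrow> 'y measure
                   \<Rightarrow> ('g \<times> 'y \<Rightarrow> complex) set \<Rightarrow> ('g \<Rightarrow> 'y \<Rightarrow> 'g \<times> 'y \<Rightarrow> complex)
                   \<Rightarrow> (('g \<Rightarrow> complex) \<Rightarrow> 'y \<Rightarrow> complex) \<Rightarrow> (('g \<Rightarrow> complex) \<Rightarrow> complex)
                   \<Rightarrow> ('g \<times> 'y \<Rightarrow> complex) \<Rightarrow> ('g \<times> 'y \<Rightarrow> complex)" where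
  "Vop \<nu> \<nu>h lam H K q b f = (SOME g. g \<in> H \<and>
      (AE \<xi> in restrict_space \<nu>h (Omega \<nu> K). Rop \<nu> \<nu>h lam q g \<xi> = b \<xi> * Rop \<nu> \<nu>h lam q f \<xi>))"

definition phi :: "'g::{ab_group_add, topological_space} measure \<Rightarrow> ('g \<Rightarrow> complex) measure
                   \<Rightarrow> ('g \<Rightarrow> 'y \<Rightarrow> 'g \<times> 'y \<Rightarrow> complex) \<Rightarrow> (('g \<Rightarrow> complex) \<Rightarrow> complex)
                   \<Rightarrow> 'g \<Rightarrow> 'y \<Rightarrow> 'y \<Rightarrow> complex" where
  "phi \<nu> \<nu>h K b x y v = (\<integral>\<xi>. \<xi> x * Lker \<nu> K \<xi> v y * b \<xi> \<partial>(restrict_space \<nu>h (Omega \<nu> K)))"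

end

theory Submission
  imports Defs
begin

text \<open>
  Write \<open>\<Phi>\<^sub>f = (F \<otimes> I)f\<close>, so that \<open>(Rf)(\<xi>) = \<langle>\<Phi>\<^sub>f(\<xi>, \<cdot>), q\<^sub>\<xi>\<rangle>\<close>. Since \<open>R\<close> is isometric, it preserves inner
  products, and the transform of the kernel is \<open>(R K\<^sub>x\<^sub>,\<^sub>y)(\<xi>) = cnj (\<xi>(x) q\<^sub>\<xi>(y)) \<parallel>q\<^sub>\<xi>\<parallel>\<^sup>2\<close>. The crucial point
  is that \<open>\<parallel>q\<^sub>\<xi>\<parallel> = 1\<close> for almost all \<open>\<xi> \<in> \<Omega>\<close>: surjectivity of \<open>R\<close> gives \<open>\<ge>\<close>, and a weak form of Fourier
  inversion for \<open>u \<mapsto> K\<^sub>0\<^sub>,\<^sub>y(u, y)\<close> gives \<open>\<le>\<close>. The reproducing property then reads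
  \<open>g(x, y) = \<integral>\<^sub>\<Omega> (Rg)(\<xi>) \<xi>(x) q\<^sub>\<xi>(y) d\<xi>\<close> for \<open>g \<in> H\<close>. Applied to \<open>g = V\<^sub>b f\<close> it yields
  \<open>\<integral>\<^sub>\<Omega> b Rf \<xi>(x) q\<^sub>\<xi>(y) d\<xi>\<close>; applied to the preimage \<open>h\<close> of \<open>\<xi> \<mapsto> cnj (b(\<xi>) \<xi>(x) q\<^sub>\<xi>(y))\<close> it shows
  \<open>cnj (h(u, v)) = \<phi>\<^sub>b(x - u, y, v)\<close>, and \<open>\<langle>f, h\<rangle> = \<langle>Rf, Rh\<rangle>\<close> is the claim.
\<close>

section \<open>Square-integrable functions\<close>

text \<open>The norm of \<open>q \<xi>\<close> is not among the hypotheses: \<open>q\<close> enters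
  only through the factorization of \<open>Lker\<close> on \<open>Omega\<close> and through the
  definition of \<open>R\<close>. The isometry makes \<open>K 0 y (u, y)\<close> an inverse
  transform of |q(y)|^2 ||q||^4, while the factorization says that its transform is |q(y)|^2 on
  \<open>Omega\<close>. Off \<open>Omega\<close> the definition gives only a sign, not zero, so
  testing with nonnegative transforms yields a one-sided integral inequality. It becomes a pointwise
  equality because ||q|| >= 1 fixes the sign of the difference; hence the lower bound comes first
  and needs an independent argument. A second obstacle is that F (x) I is prescribed slice by slice,
  each slice up to its own null set. A jointly measurable version has to be built before Fubini can
  be used. Likewise, what holds for almost all \<xi> with a null set depending on y is first
  exchanged by Fubini into a statement about almost all y for fixed \<xi>.\<close>

lemma square_integrable_measurable [measurable_dest]:
  "square_integrable M f \<Longrightarrow> f \<in> borel_measurable M"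
  by (simp add: square_integrable_def)

lemma square_integrable_integrable:
  "square_integrable M f \<Longrightarrow> integrable M (\<lambda>x. (cmod (f x))\<^sup>2)"
  by (simp add: square_integrable_def)

lemma square_integrable_iff_nn_integral:
  assumes [measurable]: "f \<in> borel_measurable M"
  shows "square_integrable M f \<longleftrightarrow> (\<integral>\<^sup>+x. ennreal ((cmod (f x))\<^sup>2) \<partial>M) < \<infinity>"
  unfolding square_integrable_def integrable_iff_bounded by simp

lemma nn_integral_square:
  "square_integrable M f \<Longrightarrow>
    (\<integral>\<^sup>+x. ennreal ((cmod (f x))\<^sup>2) \<partial>M) = ennreal (\<integral>x. (cmod (f x))\<^sup>2 \<partial>M)"
  by (rule nn_integral_eq_integral) (auto simp: square_integrable_def)

lemma cmod_square_add_le: "(cmod (a + b))\<^sup>2 \<le> 2 * (cmod a)\<^sup>2 + 2 * (cmod b)\<^sup>2"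
proof -
  have "(cmod (a + b))\<^sup>2 \<le> (cmod a + cmod b)\<^sup>2"
    by (simp add: norm_triangle_ineq power_mono)
  also have "\<dots> \<le> 2 * (cmod a)\<^sup>2 + 2 * (cmod b)\<^sup>2"
    by (smt (verit) power2_sum power2_diff zero_le_power2)
  finally show ?thesis .
qed

lemma square_integrable_add:
  assumes "square_integrable M f" "square_integrable M g"
  shows "square_integrable M (\<lambda>x. f x + g x)"
proof -
  note [measurable] = assms[THEN square_integrable_measurable]
  have "integrable M (\<lambda>x. (cmod (f x + g x))\<^sup>2)"
    by (rule Bochner_Integration.integrable_bound
          [where f = "\<lambda>x. 2 * (cmod (f x))\<^sup>2 + 2 * (cmod (g x))\<^sup>2"])
       (use assms in \<open>auto simp: square_integrable_def intro!: cmod_square_add_le\<close>)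
  then show ?thesis by (simp add: square_integrable_def)
qed

lemma square_integrable_cmult:
  assumes "square_integrable M f"
  shows "square_integrable M (\<lambda>x. c * f x)"
  using assms by (auto simp: square_integrable_def norm_mult power_mult_distrib)

lemma square_integrable_diff:
  assumes "square_integrable M f" "square_integrable M g"
  shows "square_integrable M (\<lambda>x. f x - g x)"
  using square_integrable_add[OF assms(1) square_integrable_cmult[OF assms(2), of "-1"]] by simp

lemma square_integrable_bound:
  assumes "square_integrable M f" and [measurable]: "g \<in> borel_measurable M"
    and "AE x in M. cmod (g x) \<le> C * cmod (f x)"
  shows "square_integrable M g"
proof -
  have "integrable M (\<lambda>x. (cmod (g x))\<^sup>2)"
  proof (rule Bochner_Integration.integrable_bound)
    show "integrable M (\<lambda>x. C\<^sup>2 * (cmod (f x))\<^sup>2)"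
      using assms(1) by (auto simp: square_integrable_def)
    show "AE x in M. norm ((cmod (g x))\<^sup>2) \<le> norm (C\<^sup>2 * (cmod (f x))\<^sup>2)"
      using assms(3) by eventually_elim (metis abs_ge_self abs_power2 norm_ge_zero order_trans
          power_mono power_mult_distrib real_norm_def)
  qed simp
  then show ?thesis by (simp add: square_integrable_def)
qed

lemma borel_measurable_cnj [measurable (raw)]:
  "f \<in> borel_measurable M \<Longrightarrow> (\<lambda>x. cnj (f x)) \<in> borel_measurable M"
  by (rule borel_measurable_continuous_on[where f = cnj]) (auto intro: continuous_intros)

lemma square_integrable_cnj:
  "square_integrable M f \<Longrightarrow> square_integrable M (\<lambda>x. cnj (f x))"
  by (auto simp: square_integrable_def)

lemma square_integrable_mult_integrable:
  assumes "square_integrable M f" "square_integrable M g"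
  shows "integrable M (\<lambda>x. f x * cnj (g x))"
proof (rule Bochner_Integration.integrable_bound
    [where f = "\<lambda>x. (cmod (f x))\<^sup>2 + (cmod (g x))\<^sup>2"])
  note [measurable] = assms[THEN square_integrable_measurable]
  show "(\<lambda>x. f x * cnj (g x)) \<in> borel_measurable M" by simp
  have "cmod a * cmod b \<le> (cmod a)\<^sup>2 + (cmod b)\<^sup>2" for a b
    using sum_squares_bound[of "cmod a" "cmod b"]
      mult_nonneg_nonneg[OF norm_ge_zero[of a] norm_ge_zero[of b]] by linarith
  then show "AE x in M. norm (f x * cnj (g x)) \<le> norm ((cmod (f x))\<^sup>2 + (cmod (g x))\<^sup>2)"
    by (auto simp: norm_mult)
qed (use assms in \<open>auto simp: square_integrable_def\<close>)

lemma Cauchy_Schwarz_integral: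
  assumes "square_integrable M f" "square_integrable M g"
  shows "(cmod (\<integral>x. f x * cnj (g x) \<partial>M))\<^sup>2 \<le>
    (\<integral>x. (cmod (f x))\<^sup>2 \<partial>M) * (\<integral>x. (cmod (g x))\<^sup>2 \<partial>M)"
proof -
  note [measurable] = assms[THEN square_integrable_measurable]
  have "ennreal (cmod (\<integral>x. f x * cnj (g x) \<partial>M)) \<le> (\<integral>\<^sup>+x. ennreal (norm (f x * cnj (g x))) \<partial>M)"
    by (rule integral_norm_bound_ennreal) (rule square_integrable_mult_integrable[OF assms])
  also have "\<dots> = (\<integral>\<^sup>+x. ennreal (cmod (f x)) * ennreal (cmod (g x)) \<partial>M)"
    by (simp add: norm_mult ennreal_mult')
  finally have "(ennreal (cmod (\<integral>x. f x * cnj (g x) \<partial>M)))\<^sup>2 \<le>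
      (\<integral>\<^sup>+x. ennreal (cmod (f x)) * ennreal (cmod (g x)) \<partial>M)\<^sup>2"
    by (rule power_mono) simp
  also have "\<dots> \<le> (\<integral>\<^sup>+x. (ennreal (cmod (f x)))\<^sup>2 \<partial>M) * (\<integral>\<^sup>+x. (ennreal (cmod (g x)))\<^sup>2 \<partial>M)"
    by (rule Cauchy_Schwarz_nn_integral) simp_all
  also have "\<dots> = ennreal ((\<integral>x. (cmod (f x))\<^sup>2 \<partial>M) * (\<integral>x. (cmod (g x))\<^sup>2 \<partial>M))"
    by (simp add: ennreal_power nn_integral_square[OF assms(1)] nn_integral_square[OF assms(2)]
        ennreal_mult)
  finally show ?thesis
    by (simp add: ennreal_power)
qed

section \<open>Inner products and L2 limits by way of squared norms\<close>

lemma polarization: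
  fixes a b :: complex
  shows "4 * (a * cnj b) =
    complex_of_real ((cmod (a + 1 * b))\<^sup>2) - complex_of_real ((cmod (a + (-1) * b))\<^sup>2)
    + \<i> * complex_of_real ((cmod (a + \<i> * b))\<^sup>2) - \<i> * complex_of_real ((cmod (a + (-\<i>) * b))\<^sup>2)"
  by (simp add: complex_eq_iff cmod_power2 algebra_simps) (simp add: power2_eq_square algebra_simps)

lemma integral_polarization:
  assumes "square_integrable M f" "square_integrable M g"
  shows "4 * (\<integral>x. f x * cnj (g x) \<partial>M) =
    complex_of_real (\<integral>x. (cmod (f x + 1 * g x))\<^sup>2 \<partial>M)
    - complex_of_real (\<integral>x. (cmod (f x + (-1) * g x))\<^sup>2 \<partial>M)
    + \<i> * complex_of_real (\<integral>x. (cmod (f x + \<i> * g x))\<^sup>2 \<partial>M)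
    - \<i> * complex_of_real (\<integral>x. (cmod (f x + (-\<i>) * g x))\<^sup>2 \<partial>M)"
proof -
  have I: "integrable M (\<lambda>x. complex_of_real ((cmod (f x + c * g x))\<^sup>2))" for c
    using square_integrable_add[OF assms(1) square_integrable_cmult[OF assms(2)]]
    by (intro integrable_of_real) (simp add: square_integrable_def)
  have "4 * (\<integral>x. f x * cnj (g x) \<partial>M) = (\<integral>x. 4 * (f x * cnj (g x)) \<partial>M)"
    by simp
  also have "\<dots> = (\<integral>x. complex_of_real ((cmod (f x + 1 * g x))\<^sup>2)
       - complex_of_real ((cmod (f x + (-1) * g x))\<^sup>2)
    + \<i> * complex_of_real ((cmod (f x + \<i> * g x))\<^sup>2)
    - \<i> * complex_of_real ((cmod (f x + (-\<i>) * g x))\<^sup>2) \<partial>M)"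
    by (subst polarization) (rule refl)
  also have "\<dots> = (\<integral>x. complex_of_real ((cmod (f x + 1 * g x))\<^sup>2) \<partial>M)
       - (\<integral>x. complex_of_real ((cmod (f x + (-1) * g x))\<^sup>2) \<partial>M)
    + \<i> * (\<integral>x. complex_of_real ((cmod (f x + \<i> * g x))\<^sup>2) \<partial>M)
    - \<i> * (\<integral>x. complex_of_real ((cmod (f x + (-\<i>) * g x))\<^sup>2) \<partial>M)"
    by (subst Bochner_Integration.integral_diff Bochner_Integration.integral_add;
        (intro I Bochner_Integration.integrable_diff Bochner_Integration.integrable_add
          integrable_mult_right)?)+ simp
  finally show ?thesis by (simp only: integral_complex_of_real)
qed

text \<open>Polarization turns isometry of norms into isometry of inner products. The hypothesis is
  about the combinations \<open>F x + c * G x\<close> and not about a linear map, because the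
  Fourier transform is additive only on integrable functions and \<open>R\<close> only almost
  everywhere. For the same reason \<open>polarization\<close> keeps the coefficients
  \<open>1\<close> and \<open>-1\<close>: all four squares then have the shape that the hypothesis
  rewrites.\<close>

lemma inner_eq_if_norm_eq:
  assumes "square_integrable M f" "square_integrable M g"
    and "square_integrable N F" "square_integrable N G"
    and "\<And>c. (\<integral>x. (cmod (F x + c * G x))\<^sup>2 \<partial>N) = (\<integral>x. (cmod (f x + c * g x))\<^sup>2 \<partial>M)"
  shows "(\<integral>x. F x * cnj (G x) \<partial>N) = (\<integral>x. f x * cnj (g x) \<partial>M)"
proof -
  have "4 * (\<integral>x. F x * cnj (G x) \<partial>N) = 4 * (\<integral>x. f x * cnj (g x) \<partial>M)"
    by (simp only: integral_polarization[OF assms(1,2)] integral_polarization[OF assms(3,4)] assms(5))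
  then show ?thesis by simp
qed

text \<open>A triangle inequality that stays with squared norms. In applications the
  \<open>L2dist2\<close> term tends to 0 for fixed \<open>e\<close>, and afterwards \<open>e\<close>
  tends to 0.\<close>

lemma integral_square_le_perturbed:
  assumes "square_integrable M f" "square_integrable M g" and "e > 0"
  shows "(\<integral>x. (cmod (f x))\<^sup>2 \<partial>M) \<le> (1 + e) * (\<integral>x. (cmod (g x))\<^sup>2 \<partial>M) + (1 + 1 / e) * L2dist2 M g f"
proof -
  have *: "(cmod a)\<^sup>2 \<le> (1 + e) * (cmod b)\<^sup>2 + (1 + 1 / e) * (cmod (b - a))\<^sup>2" for a b
  proof -
    let ?s = "cmod b" and ?t = "cmod (b - a)"
    \<comment> \<open>The expansion bounds the cross term 2st of (s + t)^2 by e s^2 + t^2 /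
      e.\<close>
    have "0 \<le> (sqrt e * ?s - ?t / sqrt e)\<^sup>2" by simp
    also have "\<dots> = e * ?s\<^sup>2 + (1 / e) * ?t\<^sup>2 - 2 * ?s * ?t"
      using \<open>e > 0\<close> by (simp add: power2_diff power_mult_distrib power_divide)
    finally have "(?s + ?t)\<^sup>2 \<le> (1 + e) * ?s\<^sup>2 + (1 + 1 / e) * ?t\<^sup>2"
      by (simp add: power2_sum algebra_simps)
    moreover have "cmod a \<le> ?s + ?t"
      using norm_triangle_ineq4[of b "b - a"] by simp
    ultimately show ?thesis
      by (meson norm_ge_zero order_trans power_mono)
  qed
  have i: "integrable M (\<lambda>x. (cmod (g x - f x))\<^sup>2)"
    using square_integrable_diff[OF assms(2,1)] by (simp add: square_integrable_def)
  have "(\<integral>x. (cmod (f x))\<^sup>2 \<partial>M) \<le> (\<integral>x. (1 + e) * (cmod (g x))\<^sup>2 + (1 + 1 / e) * (cmod (g x - f x))\<^sup>2 \<partial>M)"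
    by (rule integral_mono) (use assms i in \<open>auto simp: square_integrable_def intro!: *\<close>)
  also have "\<dots> = (1 + e) * (\<integral>x. (cmod (g x))\<^sup>2 \<partial>M) + (1 + 1 / e) * L2dist2 M g f"
    unfolding L2dist2_def by (subst Bochner_Integration.integral_add) (use assms i in \<open>auto simp: square_integrable_def\<close>)
  finally show ?thesis .
qed

lemma L2dist2_nonneg: "0 \<le> L2dist2 M f g"
  unfolding L2dist2_def by simp

lemma L2dist2_commute: "L2dist2 M f g = L2dist2 M g f"
  unfolding L2dist2_def by (simp add: norm_minus_commute)

lemma L2dist2_lincomb_tendsto:
  assumes lim: "(\<lambda>n. L2dist2 M (s n) f) \<longlonglongrightarrow> 0" "(\<lambda>n. L2dist2 M (t n) g) \<longlonglongrightarrow> 0"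
    and int: "\<And>n. square_integrable M (s n)" "\<And>n. square_integrable M (t n)"
      "square_integrable M f" "square_integrable M g"
  shows "(\<lambda>n. L2dist2 M (\<lambda>x. s n x + c * t n x) (\<lambda>x. f x + c * g x)) \<longlonglongrightarrow> 0"
proof (rule tendsto_sandwich[OF _ _ tendsto_const])
  show "\<forall>\<^sub>F n in sequentially. 0 \<le> L2dist2 M (\<lambda>x. s n x + c * t n x) (\<lambda>x. f x + c * g x)"
    by (simp add: L2dist2_nonneg)
  show "(\<lambda>n. 2 * L2dist2 M (s n) f + 2 * (cmod c)\<^sup>2 * L2dist2 M (t n) g) \<longlonglongrightarrow> 0"
    by (rule tendsto_eq_intros lim refl)+ simp
  have "L2dist2 M (\<lambda>x. s n x + c * t n x) (\<lambda>x. f x + c * g x)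
      \<le> 2 * L2dist2 M (s n) f + 2 * (cmod c)\<^sup>2 * L2dist2 M (t n) g" for n
  proof -
    have i: "integrable M (\<lambda>x. (cmod (s n x - f x))\<^sup>2)" "integrable M (\<lambda>x. (cmod (t n x - g x))\<^sup>2)"
      "integrable M (\<lambda>x. (cmod (s n x + c * t n x - (f x + c * g x)))\<^sup>2)"
      using square_integrable_diff[OF int(1,3), of n] square_integrable_diff[OF int(2,4), of n]
        square_integrable_diff[OF square_integrable_add[OF int(1) square_integrable_cmult[OF int(2)]]
          square_integrable_add[OF int(3) square_integrable_cmult[OF int(4)]], of n c n c]
      by (simp_all add: square_integrable_def)
    have "L2dist2 M (\<lambda>x. s n x + c * t n x) (\<lambda>x. f x + c * g x)
      \<le> (\<integral>x. 2 * (cmod (s n x - f x))\<^sup>2 + 2 * (cmod c)\<^sup>2 * (cmod (t n x - g x))\<^sup>2 \<partial>M)"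
      unfolding L2dist2_def
    proof (rule integral_mono)
      fix x
      have eq: "s n x + c * t n x - (f x + c * g x) = (s n x - f x) + c * (t n x - g x)"
        by (simp add: algebra_simps)
      show "(cmod (s n x + c * t n x - (f x + c * g x)))\<^sup>2
          \<le> 2 * (cmod (s n x - f x))\<^sup>2 + 2 * (cmod c)\<^sup>2 * (cmod (t n x - g x))\<^sup>2"
        unfolding eq using cmod_square_add_le[of "s n x - f x" "c * (t n x - g x)"]
        by (simp add: norm_mult power_mult_distrib)
    qed (use i in auto)
    also have "\<dots> = 2 * L2dist2 M (s n) f + 2 * (cmod c)\<^sup>2 * L2dist2 M (t n) g"
      unfolding L2dist2_def using i by simp
    finally show ?thesis .
  qed
  then show "\<forall>\<^sub>F n in sequentially. L2dist2 M (\<lambda>x. s n x + c * t n x) (\<lambda>x. f x + c * g x)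
      \<le> 2 * L2dist2 M (s n) f + 2 * (cmod c)\<^sup>2 * L2dist2 M (t n) g" by simp
qed

lemma AE_eq_if_L2dist2_zero:
  assumes "square_integrable M f" "square_integrable M g" "L2dist2 M f g = 0"
  shows "AE x in M. f x = g x"
proof -
  have "integrable M (\<lambda>x. (cmod (f x - g x))\<^sup>2)"
    using square_integrable_diff[OF assms(1,2)] by (simp add: square_integrable_def)
  then have "AE x in M. (cmod (f x - g x))\<^sup>2 = 0"
    using assms(3) unfolding L2dist2_def by (subst integral_nonneg_eq_0_iff_AE[symmetric]) auto
  then show ?thesis by eventually_elim simp
qed

text \<open>At this rate the whole sequence converges almost everywhere, so the L2 limit is the
  explicit pointwise \<open>lim\<close> and no subsequence has to be chosen. The explicit formula is
  what makes the limit jointly measurable when the sequence depends on a parameter, as in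
  \<open>is_FI_exists\<close>.\<close>

lemma L2_fast_Cauchy_limit:
  assumes s: "\<And>k. square_integrable M (s k)"
    and fast: "\<And>j k. k \<le> j \<Longrightarrow> L2dist2 M (s j) (s k) \<le> C / 8 ^ k"
  shows "square_integrable M (\<lambda>x. lim (\<lambda>k. s k x))"
    and "(\<lambda>k. L2dist2 M (s k) (\<lambda>x. lim (\<lambda>k. s k x))) \<longlonglongrightarrow> 0"
proof -
  note [measurable] = s[THEN square_integrable_measurable]
  let ?l = "\<lambda>x. lim (\<lambda>k. s k x)"
  have C: "C \<ge> 0" using fast[of 0 0] L2dist2_nonneg[of M "s 0" "s 0"] by simp
  have int: "integrable M (\<lambda>x. (cmod (s j x - s k x))\<^sup>2)" for j k
    using square_integrable_diff[OF s s] by (simp add: square_integrable_def)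
  have nn: "(\<integral>\<^sup>+x. ennreal ((cmod (s j x - s k x))\<^sup>2) \<partial>M) = ennreal (L2dist2 M (s j) (s k))" for j k
    unfolding L2dist2_def by (rule nn_integral_eq_integral[OF int]) simp
  \<comment> \<open>The weight \<open>4 ^ k\<close> is a compromise: against the rate
    \<open>8 ^ k\<close> it leaves a geometric series of ratio 1/2, and finiteness of the weighted
    sum at x bounds the increments by a multiple of 2^-k, which is summable.\<close>
  have "(\<integral>\<^sup>+x. (\<Sum>k. ennreal (4 ^ k * (cmod (s (Suc k) x - s k x))\<^sup>2)) \<partial>M)
      = (\<Sum>k. (\<integral>\<^sup>+x. ennreal (4 ^ k * (cmod (s (Suc k) x - s k x))\<^sup>2) \<partial>M))"
    by (rule nn_integral_suminf) simp
  also have "\<dots> = (\<Sum>k. ennreal (4 ^ k * L2dist2 M (s (Suc k)) (s k)))"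
    by (simp add: ennreal_mult' nn_integral_cmult nn L2dist2_nonneg)
  also have "\<dots> \<le> (\<Sum>k. ennreal (C * (1 / 2) ^ k))"
  proof (intro suminf_le summableI ennreal_leI)
    fix k
    have "4 ^ k * L2dist2 M (s (Suc k)) (s k) \<le> 4 ^ k * (C / 8 ^ k)"
      using fast[of k "Suc k"] by (intro mult_left_mono) auto
    also have "\<dots> = C * ((4 / 8) ^ k)" unfolding power_divide by simp
    finally show "4 ^ k * L2dist2 M (s (Suc k)) (s k) \<le> C * (1 / 2) ^ k" by simp
  qed
  also have "\<dots> = ennreal (\<Sum>k. C * (1 / 2) ^ k)"
    by (rule suminf_ennreal2) (use C in \<open>auto intro!: summable_mult summable_geometric\<close>)
  also have "\<dots> < \<infinity>" by simp
  finally have "AE x in M. (\<Sum>k. ennreal (4 ^ k * (cmod (s (Suc k) x - s k x))\<^sup>2)) \<noteq> \<infinity>"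
    by (intro nn_integral_PInf_AE) auto
  then have conv: "AE x in M. (\<lambda>k. s k x) \<longlonglongrightarrow> ?l x"
  proof eventually_elim
    case (elim x)
    have "summable (\<lambda>k. 4 ^ k * (cmod (s (Suc k) x - s k x))\<^sup>2)"
      by (rule summable_suminf_not_top) (use elim in \<open>auto simp: infinity_ennreal_def\<close>)
    then have "bounded (range (\<lambda>k. 4 ^ k * (cmod (s (Suc k) x - s k x))\<^sup>2))"
      by (intro convergent_imp_bounded[OF summable_LIMSEQ_zero])
    then obtain B where "norm (4 ^ k * (cmod (s (Suc k) x - s k x))\<^sup>2) \<le> B" for k
      unfolding bounded_iff by blast
    then have B: "(2 ^ k * cmod (s (Suc k) x - s k x))\<^sup>2 \<le> B" for k
    proof -
      have "((2::real) ^ k)\<^sup>2 = 4 ^ k"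
        by (metis power2_eq_square power_mult_distrib mult_2 numeral_Bit0 numeral_times_numeral
            semiring_norm(13))
      then show ?thesis
        using \<open>norm (4 ^ k * (cmod (s (Suc k) x - s k x))\<^sup>2) \<le> B\<close> by (simp add: power_mult_distrib)
    qed
    have le: "cmod (s (Suc k) x - s k x) \<le> sqrt B * (1 / 2) ^ k" for k
    proof -
      have "2 ^ k * cmod (s (Suc k) x - s k x) \<le> sqrt B"
        using real_le_rsqrt[OF B[of k]] .
      then show ?thesis by (simp add: power_divide field_simps)
    qed
    have "summable (\<lambda>k. s (Suc k) x - s k x)"
      by (rule summable_comparison_test'[where N = 0 and g = "\<lambda>k. sqrt B * (1 / 2) ^ k"])
         (use le in \<open>auto intro!: summable_mult summable_geometric\<close>)
    then have "convergent (\<lambda>k. s k x)"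
    proof -
      assume "summable (\<lambda>k. s (Suc k) x - s k x)"
      then have "(\<lambda>n. \<Sum>k<n. s (Suc k) x - s k x) \<longlonglongrightarrow> (\<Sum>k. s (Suc k) x - s k x)"
        by (rule summable_LIMSEQ)
      then have "(\<lambda>n. (s n x - s 0 x) + s 0 x) \<longlonglongrightarrow> (\<Sum>k. s (Suc k) x - s k x) + s 0 x"
        unfolding sum_lessThan_telescope[of "\<lambda>k. s k x"] by (rule tendsto_add[OF _ tendsto_const])
      then have "(\<lambda>n. s n x) \<longlonglongrightarrow> (\<Sum>k. s (Suc k) x - s k x) + s 0 x"
        by simp
      then show ?thesis by (rule convergentI)
    qed
    then show ?case by (rule convergent_LIMSEQ_iff[THEN iffD1])
  qed
  \<comment> \<open>For fixed k, Fatou's lemma in j carries the Cauchy bound over to the limit. This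
    gives both square integrability and the rate of convergence.\<close>
  have fatou: "(\<integral>\<^sup>+x. ennreal ((cmod (s k x - ?l x))\<^sup>2) \<partial>M) \<le> ennreal (C / 8 ^ k)" for k
  proof -
    have "(\<integral>\<^sup>+x. ennreal ((cmod (s k x - ?l x))\<^sup>2) \<partial>M)
        = (\<integral>\<^sup>+x. liminf (\<lambda>j. ennreal ((cmod (s j x - s k x))\<^sup>2)) \<partial>M)"
    proof (rule nn_integral_cong_AE)
      show "AE x in M. ennreal ((cmod (s k x - ?l x))\<^sup>2) = liminf (\<lambda>j. ennreal ((cmod (s j x - s k x))\<^sup>2))"
        using conv
      proof eventually_elim
        case (elim x)
        then have "(\<lambda>j. ennreal ((cmod (s j x - s k x))\<^sup>2)) \<longlonglongrightarrow> ennreal ((cmod (?l x - s k x))\<^sup>2)"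
          by (intro tendsto_ennrealI tendsto_power tendsto_norm tendsto_diff tendsto_const)
        from lim_imp_Liminf[OF _ this] show ?case
          by (simp add: norm_minus_commute)
      qed
    qed
    also have "\<dots> \<le> liminf (\<lambda>j. \<integral>\<^sup>+x. ennreal ((cmod (s j x - s k x))\<^sup>2) \<partial>M)"
      by (rule nn_integral_liminf) simp
    also have "\<dots> \<le> ennreal (C / 8 ^ k)"
    proof (rule Liminf_le)
      show "\<forall>\<^sub>F j in sequentially. (\<integral>\<^sup>+x. ennreal ((cmod (s j x - s k x))\<^sup>2) \<partial>M) \<le> ennreal (C / 8 ^ k)"
        using eventually_ge_at_top[of k]
        by eventually_elim (simp add: nn fast ennreal_leI)
    qed simp
    finally show ?thesis .
  qed
  have dint: "square_integrable M (\<lambda>x. s k x - ?l x)" for k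
    using fatou[of k] by (subst square_integrable_iff_nn_integral) (auto intro: le_less_trans)
  show "square_integrable M ?l"
    using square_integrable_diff[OF s dint, of 0 0] by simp
  have "L2dist2 M (s k) ?l \<le> C * (1 / 8) ^ k" for k
  proof -
    have "ennreal (L2dist2 M (s k) ?l) \<le> ennreal (C / 8 ^ k)"
      using fatou[of k] nn_integral_square[OF dint, of k] by (simp add: L2dist2_def)
    then show ?thesis using C by (simp add: ennreal_le_iff power_divide)
  qed
  then have le: "\<forall>k. L2dist2 M (s k) ?l \<le> C * (1 / 8) ^ k" by blast
  have "(\<lambda>k. (1 / 8 :: real) ^ k) \<longlonglongrightarrow> 0"
    by (rule LIMSEQ_power_zero) simp
  then have lim0: "(\<lambda>k. C * (1 / 8) ^ k) \<longlonglongrightarrow> 0"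
    by (rule tendsto_mult_right_zero)
  show "(\<lambda>k. L2dist2 M (s k) ?l) \<longlonglongrightarrow> 0"
    by (rule tendsto_sandwich[OF _ always_eventually[OF le] tendsto_const lim0])
       (rule always_eventually, rule allI, rule L2dist2_nonneg)
qed

section \<open>Haar measure on a metrizable \<open>\<sigma>\<close>-compact abelian group\<close>

text \<open>Replace u by the first point of the dense sequence within
  \<open>1 / real (Suc n)\<close> of it. This point takes countably many values, so the
  approximation is measurable, and continuity in u gives pointwise convergence. The lemma supplies
  joint measurability of the group addition and of the evaluation of characters.\<close>

lemma borel_measurable_caratheodory:
  fixes F :: "'a \<Rightarrow> 'g::metric_space \<Rightarrow> 'b::metric_space" and d :: "nat \<Rightarrow> 'g"
  assumes dense: "\<And>x e. e > 0 \<Longrightarrow> \<exists>k. dist (d k) x < e"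
    and meas: "\<And>u. (\<lambda>x. F x u) \<in> borel_measurable M"
    and cont: "\<And>x. x \<in> space M \<Longrightarrow> continuous_on UNIV (F x)"
    and [measurable_cong]: "sets N = sets borel"
  shows "(\<lambda>p. F (fst p) (snd p)) \<in> borel_measurable (M \<Otimes>\<^sub>M N)"
proof (rule borel_measurable_LIMSEQ_metric)
  define k where "k n u = (LEAST j. dist (d j) u < 1 / real (Suc n))" for n u
  have k: "dist (d (k n u)) u < 1 / real (Suc n)" for n u
    unfolding k_def by (rule LeastI_ex) (rule dense, simp)
  have ball: "ball (d j) (1 / real (Suc n)) \<in> sets borel" for j n
    by (rule borel_open) simp
  have "Measurable.pred borel (\<lambda>u. dist (d j) u < 1 / real (Suc n))" for j n
    using ball[of j n] by (simp add: pred_def ball_def)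
  then have k_meas [measurable]: "k n \<in> borel \<rightarrow>\<^sub>M count_space UNIV" for n
    unfolding k_def by (intro measurable_Least)
  show "(\<lambda>p. F (fst p) (d (k n (snd p)))) \<in> borel_measurable (M \<Otimes>\<^sub>M N)" for n
  proof (rule measurable_compose_countable[where f = "\<lambda>i p. F (fst p) (d i)"])
    show "(\<lambda>p. F (fst p) (d i)) \<in> borel_measurable (M \<Otimes>\<^sub>M N)" for i
      by (rule measurable_compose[OF measurable_fst meas])
    show "(\<lambda>p. k n (snd p)) \<in> M \<Otimes>\<^sub>M N \<rightarrow>\<^sub>M count_space UNIV"
      by measurable
  qed
  fix p assume p: "p \<in> space (M \<Otimes>\<^sub>M N)"
  have "(\<lambda>n. dist (d (k n (snd p))) (snd p)) \<longlonglongrightarrow> 0"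
    by (rule tendsto_sandwich[OF _ _ tendsto_const LIMSEQ_Suc[OF lim_1_over_n]])
       (use k in \<open>auto intro!: always_eventually less_imp_le\<close>)
  then have "(\<lambda>n. d (k n (snd p))) \<longlonglongrightarrow> snd p"
    by (subst tendsto_dist_iff)
  then show "(\<lambda>n. F (fst p) (d (k n (snd p)))) \<longlonglongrightarrow> F (fst p) (snd p)"
    using cont[of "fst p"] p
    by (intro continuous_on_tendsto_compose[of UNIV "F (fst p)"]) (auto simp: space_pair_measure)
qed

locale lca_haar =
  fixes \<nu> :: "'g::{ab_group_add, metric_space} measure"
  assumes G: "lca_metrizable_sigma_compact TYPE('g)"
    and haar: "haar_on euclidean (+) \<nu>"
begin

lemma sets_haar [measurable_cong]: "sets \<nu> = sets borel"
  using haar unfolding haar_on_def borel_of_def borel_def by (simp add: open_openin[symmetric])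

lemma space_haar [simp]: "space \<nu> = UNIV"
  using haar unfolding haar_on_def by simp

lemma exhaustion:
  obtains C :: "nat \<Rightarrow> 'g set" where "incseq C" "\<And>n. compact (C n)" "(\<Union>n. C n) = UNIV"
proof -
  obtain C :: "nat \<Rightarrow> 'g set" where C: "\<And>n. compact (C n)" "(\<Union>n. C n) = UNIV"
    using G unfolding lca_metrizable_sigma_compact_def by blast
  show ?thesis
  proof
    show "incseq (\<lambda>n. \<Union>i\<le>n. C i)" by (force simp: incseq_def)
    show "compact (\<Union>i\<le>n. C i)" for n using C by (intro compact_UN) auto
    show "(\<Union>n. \<Union>i\<le>n. C i) = UNIV" using C(2) by auto
  qed
qed

text \<open>Compact sets are totally bounded, so finite nets of mesh \<open>1 / real (Suc m)\<close>
  in the sets of an exhaustion have a countable dense union.\<close>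

lemma dense_sequence:
  obtains d :: "nat \<Rightarrow> 'g" where "\<And>x e. e > 0 \<Longrightarrow> \<exists>k. dist (d k) x < e"
proof -
  obtain C :: "nat \<Rightarrow> 'g set" where C: "incseq C" "\<And>n. compact (C n)" "(\<Union>n. C n) = UNIV"
    using exhaustion by blast
  have "\<exists>k. finite k \<and> C n \<subseteq> (\<Union>x\<in>k. ball x (1 / real (Suc m)))" for n m
    using C(2)[of n] unfolding compact_eq_totally_bounded by (metis of_nat_0_less_iff zero_less_Suc zero_less_divide_1_iff)
  then obtain k where k: "\<And>n m. finite (k n m)" "\<And>n m. C n \<subseteq> (\<Union>x\<in>k n m. ball x (1 / real (Suc m)))"
    by metis
  \<comment> \<open>The element 0 makes the set nonempty, so that \<open>from_nat_into\<close>
    enumerates it.\<close>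
  let ?D = "insert 0 (\<Union>n m. k n m)"
  have "countable ?D" using k(1) by (intro countable_insert countable_UN) (auto intro: countable_finite)
  moreover have "\<exists>y\<in>?D. dist y x < e" if "e > 0" for x e
  proof -
    obtain m where m: "1 / real (Suc m) < e" using \<open>e > 0\<close> nat_approx_posE by blast
    obtain n where "x \<in> C n" using C(3) by auto
    then obtain y where "y \<in> k n m" "dist y x < 1 / real (Suc m)" using k(2)[of n m] by auto
    then show ?thesis using m by force
  qed
  ultimately show ?thesis
    using that[of "from_nat_into ?D"] by (metis from_nat_into_surj insert_not_empty)
qed

lemma borel_measurable_plus_group [measurable (raw)]:
  fixes f g :: "'a \<Rightarrow> 'g"
  assumes [measurable]: "f \<in> borel_measurable M" "g \<in> borel_measurable M"
  shows "(\<lambda>x. f x + g x) \<in> borel_measurable M"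
proof -
  obtain d :: "nat \<Rightarrow> 'g" where d: "\<And>x e. e > 0 \<Longrightarrow> \<exists>k. dist (d k) x < e"
    using dense_sequence by blast
  have cont: "continuous_on UNIV (\<lambda>p::'g \<times> 'g. fst p + snd p)"
    using G unfolding lca_metrizable_sigma_compact_def by simp
  have c1: "continuous_on UNIV (\<lambda>x. x + u)" and c2: "continuous_on UNIV (\<lambda>x. u + x)" for u :: 'g
    using continuous_on_compose2[OF cont, of UNIV "\<lambda>x. (x, u)"]
      continuous_on_compose2[OF cont, of UNIV "\<lambda>x. (u, x)"]
    by (simp_all add: continuous_on_Pair)
  have "(\<lambda>p. fst p + snd p) \<in> borel_measurable (borel \<Otimes>\<^sub>M (borel :: 'g measure))"
    by (rule borel_measurable_caratheodory[OF d]) (auto intro: borel_measurable_continuous_onI c1 c2)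
  from measurable_compose[OF _ this, of "\<lambda>x. (f x, g x)" M] show ?thesis by simp
qed

lemma borel_measurable_uminus_group [measurable (raw)]:
  fixes f :: "'a \<Rightarrow> 'g"
  assumes [measurable]: "f \<in> borel_measurable M"
  shows "(\<lambda>x. - f x) \<in> borel_measurable M"
  by (rule borel_measurable_continuous_on[where f = uminus, OF _ assms])
     (use G in \<open>simp add: lca_metrizable_sigma_compact_def\<close>)

lemma borel_measurable_diff_group [measurable (raw)]:
  fixes f g :: "'a \<Rightarrow> 'g"
  assumes [measurable]: "f \<in> borel_measurable M" "g \<in> borel_measurable M"
  shows "(\<lambda>x. f x - g x) \<in> borel_measurable M"
  unfolding diff_conv_add_uminus by measurable

section \<open>Finiteness, translation and inversion invariance of Haar measure\<close>

lemma emeasure_compact: "compact A \<Longrightarrow> emeasure \<nu> A < \<infinity>"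
  using haar unfolding haar_on_def by (simp add: compactin_euclidean_iff)

lemma emeasure_open_pos: "open U \<Longrightarrow> U \<noteq> {} \<Longrightarrow> emeasure \<nu> U > 0"
  using haar unfolding haar_on_def by auto

sublocale sigma_finite_measure \<nu>
proof
  obtain C :: "nat \<Rightarrow> 'g set" where C: "incseq C" "\<And>n. compact (C n)" "(\<Union>n. C n) = UNIV"
    using exhaustion by blast
  show "\<exists>A. countable A \<and> A \<subseteq> sets \<nu> \<and> \<Union>A = space \<nu> \<and> (\<forall>a\<in>A. emeasure \<nu> a \<noteq> \<infinity>)"
    using C emeasure_compact
    by (intro exI[of _ "range C"]) (auto simp: sets_haar borel_compact less_top[symmetric])
qed

lemma finite_ball:
  obtains r where "r > 0" "emeasure \<nu> (ball 0 r) < \<infinity>"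
proof -
  have "locally compact (UNIV :: 'g set)"
    using G unfolding lca_metrizable_sigma_compact_def by simp
  then obtain U V where UV: "open U" "compact V" "(0::'g) \<in> U" "U \<subseteq> V"
    by (metis UNIV_I locallyE open_UNIV openin_open_eq subtopology_UNIV open_openin)
  then obtain r where "r > 0" "ball 0 r \<subseteq> U" by (meson open_contains_ball)
  moreover have "emeasure \<nu> (ball 0 r) \<le> emeasure \<nu> V"
    using UV \<open>ball 0 r \<subseteq> U\<close> by (intro emeasure_mono) (auto simp: sets_haar borel_compact)
  ultimately show ?thesis using that emeasure_compact[OF UV(2)] by (meson le_less_trans)
qed

lemma distr_translate: "distr \<nu> borel (\<lambda>u. u + a) = \<nu>"
proof (rule measure_eqI)
  fix A assume "A \<in> sets (distr \<nu> borel (\<lambda>u. u + a))"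
  then have A: "A \<in> sets borel" by simp
  have "(\<lambda>u. u + a) -` A = (+) (- a) ` A"
    by (force simp: image_iff algebra_simps)
  moreover have "emeasure \<nu> ((+) (- a) ` A) = emeasure \<nu> A"
  proof -
    have "\<forall>a\<in>topspace euclidean. \<forall>A\<in>sets \<nu>. emeasure \<nu> ((+) a ` A) = emeasure \<nu> A"
      using haar unfolding haar_on_def by blast
    then show ?thesis using A unfolding sets_haar topspace_euclidean by blast
  qed
  ultimately show "emeasure (distr \<nu> borel (\<lambda>u. u + a)) A = emeasure \<nu> A"
    using A by (simp add: emeasure_distr)
qed (simp add: sets_haar)

lemma nn_integral_translate:
  assumes [measurable]: "f \<in> borel_measurable borel"
  shows "(\<integral>\<^sup>+u. f (u + a) \<partial>\<nu>) = (\<integral>\<^sup>+u. f u \<partial>\<nu>)"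
  using nn_integral_distr[of "\<lambda>u. u + a" \<nu> borel f] by (simp add: distr_translate)

text \<open>Inversion invariance follows from translation invariance and commutativity. The double
  integral of f(u - v) g(-v) equals (int f) J when u is integrated first, where J is the integral of
  g(-u). After the shift v -> v + u it equals J times the integral of f(-u), and J can be
  cancelled.\<close>

lemma nn_integral_uminus:
  assumes [measurable]: "f \<in> borel_measurable borel"
  shows "(\<integral>\<^sup>+u. f (- u) \<partial>\<nu>) = (\<integral>\<^sup>+u. f u \<partial>\<nu>)"
proof -
  interpret PP: pair_sigma_finite \<nu> \<nu> ..
  obtain r where r: "r > 0" "emeasure \<nu> (ball 0 r) < \<infinity>" using finite_ball by blast
  \<comment> \<open>Symmetrizing the ball makes J the measure of \<open>S\<close> without inversion
    invariance, which is the claim itself. Thus J is known to be positive and finite.\<close>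
  define S where "S = ball (0::'g) r \<inter> uminus -` ball 0 r"
  have "open (uminus -` ball (0::'g) r)"
    using G by (intro open_vimage) (auto simp: lca_metrizable_sigma_compact_def)
  then have "open S" unfolding S_def by auto
  have "0 \<in> S" using r by (simp add: S_def)
  have [measurable]: "S \<in> sets borel" using \<open>open S\<close> by simp
  define g :: "'g \<Rightarrow> ennreal" where "g = indicator S"
  have [measurable]: "g \<in> borel_measurable borel" unfolding g_def by simp
  have g_sym: "g (- u) = g u" for u by (auto simp: g_def S_def indicator_def)
  have J: "(\<integral>\<^sup>+u. g (- u) \<partial>\<nu>) = emeasure \<nu> S"
    unfolding g_sym by (simp add: g_def sets_haar)
  have "emeasure \<nu> S \<le> emeasure \<nu> (ball 0 r)"
    by (rule emeasure_mono) (auto simp: S_def sets_haar)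
  then have J_fin: "emeasure \<nu> S < \<infinity>" using r by (rule_tac le_less_trans)
  have J_pos: "emeasure \<nu> S > 0" using emeasure_open_pos[OF \<open>open S\<close>] \<open>0 \<in> S\<close> by auto
  have "(\<integral>\<^sup>+u. f u \<partial>\<nu>) * (\<integral>\<^sup>+u. g (- u) \<partial>\<nu>) = (\<integral>\<^sup>+v. (\<integral>\<^sup>+u. f u \<partial>\<nu>) * g (- v) \<partial>\<nu>)"
    by (simp add: nn_integral_cmult)
  also have "\<dots> = (\<integral>\<^sup>+v. (\<integral>\<^sup>+u. f (u + - v) \<partial>\<nu>) * g (- v) \<partial>\<nu>)"
    by (subst nn_integral_translate) auto
  also have "\<dots> = (\<integral>\<^sup>+v. \<integral>\<^sup>+u. f (u - v) * g (- v) \<partial>\<nu> \<partial>\<nu>)"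
    by (simp add: nn_integral_multc)
  also have "\<dots> = (\<integral>\<^sup>+u. \<integral>\<^sup>+v. f (u - v) * g (- v) \<partial>\<nu> \<partial>\<nu>)"
    by (rule PP.Fubini'[of "\<lambda>u v. f (u - v) * g (- v)"]) simp
  also have "\<dots> = (\<integral>\<^sup>+u. \<integral>\<^sup>+v. f (- v) * g (- v - u) \<partial>\<nu> \<partial>\<nu>)"
  proof (rule nn_integral_cong)
    fix u
    show "(\<integral>\<^sup>+v. f (u - v) * g (- v) \<partial>\<nu>) = (\<integral>\<^sup>+v. f (- v) * g (- v - u) \<partial>\<nu>)"
      using nn_integral_translate[of "\<lambda>v. f (u - v) * g (- v)" u] by simp
  qed
  also have "\<dots> = (\<integral>\<^sup>+v. \<integral>\<^sup>+u. f (- v) * g (- v - u) \<partial>\<nu> \<partial>\<nu>)"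
    by (rule PP.Fubini'[of "\<lambda>u v. f (- v) * g (- v - u)", symmetric]) simp
  also have "\<dots> = (\<integral>\<^sup>+v. f (- v) * (\<integral>\<^sup>+u. g (- (u + v)) \<partial>\<nu>) \<partial>\<nu>)"
    by (simp add: nn_integral_cmult algebra_simps)
  also have "\<dots> = (\<integral>\<^sup>+v. f (- v) * (\<integral>\<^sup>+u. g (- u) \<partial>\<nu>) \<partial>\<nu>)"
    by (subst nn_integral_translate[of "\<lambda>u. g (- u)"]) auto
  also have "\<dots> = (\<integral>\<^sup>+u. f (- u) \<partial>\<nu>) * (\<integral>\<^sup>+u. g (- u) \<partial>\<nu>)"
    by (simp add: nn_integral_multc)
  finally show ?thesis
    using J_fin J_pos unfolding J
    by (metis ennreal_mult_cancel_left infinity_ennreal_def less_irrefl mult.commute)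
qed

lemma distr_uminus: "distr \<nu> borel uminus = \<nu>"
proof (rule measure_eqI)
  fix A assume "A \<in> sets (distr \<nu> borel (uminus :: 'g \<Rightarrow> 'g))"
  then have [measurable]: "A \<in> sets borel" by simp
  have "emeasure (distr \<nu> borel uminus) A = (\<integral>\<^sup>+u. indicator A u \<partial>distr \<nu> borel uminus)"
    by (simp add: sets_haar)
  also have "\<dots> = (\<integral>\<^sup>+u. indicator A (- u) \<partial>\<nu>)"
    by (rule nn_integral_distr) auto
  also have "\<dots> = (\<integral>\<^sup>+u. indicator A u \<partial>\<nu>)"
    by (rule nn_integral_uminus) simp
  finally show "emeasure (distr \<nu> borel uminus) A = emeasure \<nu> A"
    by (simp add: sets_haar)
qed (simp add: sets_haar)

lemma integral_uminus:
  fixes f :: "'g \<Rightarrow> complex"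
  assumes [measurable]: "f \<in> borel_measurable borel"
  shows "(\<integral>u. f (- u) \<partial>\<nu>) = (\<integral>u. f u \<partial>\<nu>)"
  using integral_distr[of uminus \<nu> borel f] by (simp add: distr_uminus)

lemma integral_translate:
  fixes f :: "'g \<Rightarrow> complex"
  assumes [measurable]: "f \<in> borel_measurable borel"
  shows "(\<integral>u. f (u + a) \<partial>\<nu>) = (\<integral>u. f u \<partial>\<nu>)"
  using integral_distr[of "\<lambda>u. u + a" \<nu> borel f] by (simp add: distr_translate)

lemma integrable_translate:
  fixes f :: "'g \<Rightarrow> 'b::{banach, second_countable_topology}"
  assumes "integrable \<nu> f"
  shows "integrable \<nu> (\<lambda>u. f (u + a))"
proof -
  have [measurable]: "f \<in> borel_measurable borel"
    using borel_measurable_integrable[OF assms] by simp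
  show ?thesis
    using assms integrable_distr_eq[of "\<lambda>u. u + a" \<nu> borel f] by (simp add: distr_translate)
qed

end

section \<open>Characters and the Fourier transform\<close>

lemma dual_charsD:
  assumes "\<xi> \<in> dual_chars"
  shows char_continuous: "continuous_on UNIV \<xi>"
    and char_add: "\<xi> (x + y) = \<xi> x * \<xi> y"
    and char_norm: "cmod (\<xi> x) = 1"
  using assms by (auto simp: dual_chars_def)

lemma char_zero: "\<xi> \<in> dual_chars \<Longrightarrow> \<xi> 0 = 1"
  using char_add[of \<xi> 0 0] char_norm[of \<xi> 0] by force

lemma char_uminus:
  assumes "\<xi> \<in> dual_chars" shows "\<xi> (- x) = cnj (\<xi> x)"
proof -
  have "\<xi> x * \<xi> (- x) = 1"
    using char_add[OF assms, of x "- x"] char_zero[OF assms] by simp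
  moreover have "\<xi> x * cnj (\<xi> x) = 1"
    by (simp add: complex_norm_square[symmetric] char_norm[OF assms])
  ultimately show ?thesis
    by (metis mult_cancel_left mult_zero_left zero_neq_one)
qed

lemma char_diff: "\<xi> \<in> dual_chars \<Longrightarrow> \<xi> (x - y) = \<xi> x * cnj (\<xi> y)"
  using char_add[of \<xi> x "- y"] char_uminus[of \<xi> y] by simp

lemma char_measurable: "\<xi> \<in> dual_chars \<Longrightarrow> \<xi> \<in> borel_measurable borel"
  by (simp add: borel_measurable_continuous_onI char_continuous)

lemma topspace_dual_topology: "topspace dual_topology = dual_chars"
  unfolding dual_topology_def topology_generated_by_topspace
proof (intro equalityI subsetI)
  fix \<gamma> :: "'a \<Rightarrow> complex" assume "\<gamma> \<in> dual_chars"
  \<comment> \<open>The empty compact set imposes no condition, so its basic neighbourhood is all of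
    \<open>dual_chars\<close>.\<close>
  then show "\<gamma> \<in> \<Union>{{\<psi>\<in>dual_chars. \<forall>x\<in>K. cmod (\<psi> x - \<gamma> x) < e} | \<gamma> K e. \<gamma> \<in> dual_chars \<and> compact K \<and> e > 0}"
    by (intro UnionI[of dual_chars] CollectI exI[of _ \<gamma>] exI[of _ "{}"] exI[of _ 1]) auto
qed auto

lemma openin_dual_topology_basic:
  "\<gamma> \<in> dual_chars \<Longrightarrow> compact K \<Longrightarrow> e > 0 \<Longrightarrow>
    openin dual_topology {\<psi>\<in>dual_chars. \<forall>x\<in>K. cmod (\<psi> x - \<gamma> x) < e}"
  unfolding dual_topology_def by (rule topology_generated_by_Basis) blast

lemma openin_dual_eval:
  assumes "open S" shows "openin dual_topology {\<xi>\<in>dual_chars. \<xi> u \<in> S}"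
proof (subst openin_subopen, intro ballI)
  fix \<gamma> assume "\<gamma> \<in> {\<xi>\<in>dual_chars. \<xi> u \<in> S}"
  then have \<gamma>: "\<gamma> \<in> dual_chars" "\<gamma> u \<in> S" by auto
  obtain e where e: "e > 0" "ball (\<gamma> u) e \<subseteq> S" using \<open>open S\<close> \<gamma> by (meson open_contains_ball)
  show "\<exists>T. openin dual_topology T \<and> \<gamma> \<in> T \<and> T \<subseteq> {\<xi>\<in>dual_chars. \<xi> u \<in> S}"
    using openin_dual_topology_basic[OF \<gamma>(1) compact_sing[of u] e(1)] \<gamma> e
    by (intro exI[of _ "{\<psi>\<in>dual_chars. \<forall>x\<in>{u}. cmod (\<psi> x - \<gamma> x) < e}"] conjI)
       (auto simp: dist_norm norm_minus_commute subset_iff)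
qed

locale plancherel_pair = lca_haar \<nu> for \<nu> :: "'g::{ab_group_add, metric_space} measure" +
  fixes \<nu>h :: "('g \<Rightarrow> complex) measure"
  assumes haar_dual: "haar_on dual_topology dual_mult \<nu>h"
    and planch: "plancherel_normalized \<nu> \<nu>h"
begin

lemma space_dual: "space \<nu>h = dual_chars"
  using haar_dual unfolding haar_on_def by (simp add: topspace_dual_topology)

lemma openin_sets_dual: "openin dual_topology U \<Longrightarrow> U \<in> sets \<nu>h"
proof -
  assume U: "openin dual_topology U"
  have "sets \<nu>h = sets (borel_of dual_topology)"
    using haar_dual unfolding haar_on_def by simp
  also have "\<dots> = sigma_sets (topspace dual_topology) {U. openin dual_topology U}"
    unfolding borel_of_def by (rule sets_measure_of) (auto dest: openin_subset)
  finally show ?thesis using U by (simp add: sigma_sets.Basic)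
qed

lemma eval_measurable: "(\<lambda>\<xi>. \<xi> u) \<in> borel_measurable \<nu>h"
proof (rule borel_measurableI)
  fix S :: "complex set" assume "open S"
  then show "(\<lambda>\<xi>. \<xi> u) -` S \<inter> space \<nu>h \<in> sets \<nu>h"
    using openin_sets_dual[OF openin_dual_eval[of S u]]
    by (simp add: space_dual vimage_def Int_def conj_commute)
qed

text \<open>The dense sequence is taken in G, where characters are continuous; in the character
  variable only the measurability of each single evaluation is used.\<close>

lemma eval_pair_measurable: "(\<lambda>p. fst p (snd p)) \<in> borel_measurable (\<nu>h \<Otimes>\<^sub>M borel)"
proof -
  obtain d :: "nat \<Rightarrow> 'g" where d: "\<And>x e. e > 0 \<Longrightarrow> \<exists>k. dist (d k) x < e"
    using dense_sequence by blast
  show ?thesis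
    by (rule borel_measurable_caratheodory[of d "\<lambda>\<xi>. \<xi>", OF d eval_measurable])
       (auto simp: space_dual char_continuous)
qed

lemma eval_compose_measurable:
  assumes [measurable]: "f \<in> M \<rightarrow>\<^sub>M \<nu>h" "g \<in> borel_measurable M"
  shows "(\<lambda>x. f x (g x)) \<in> borel_measurable M"
  using measurable_compose[OF _ eval_pair_measurable, of "\<lambda>x. (f x, g x)" M] by simp

lemma fourier_integrable:
  assumes "integrable \<nu> h" "\<xi> \<in> dual_chars"
  shows "integrable \<nu> (\<lambda>u. h u * cnj (\<xi> u))"
proof -
  have [measurable]: "\<xi> \<in> borel_measurable borel" using assms(2) by (rule char_measurable)
  note [measurable] = borel_measurable_integrable[OF assms(1)]
  show ?thesis
    by (rule Bochner_Integration.integrable_bound[OF assms(1)])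
       (auto simp: norm_mult char_norm[OF assms(2)])
qed

lemma fourier_lincomb:
  assumes "integrable \<nu> h" "integrable \<nu> k" "\<xi> \<in> dual_chars"
  shows "fourier \<nu> (\<lambda>u. h u + c * k u) \<xi> = fourier \<nu> h \<xi> + c * fourier \<nu> k \<xi>"
  unfolding fourier_def
  using fourier_integrable[OF assms(1,3)] fourier_integrable[OF assms(2,3)]
  by (simp add: distrib_right mult.assoc)

text \<open>The transform of an integrable function is continuous: some compact \<open>C n\<close>
  carries all but \<open>e / 4\<close> of the mass of |h|, uniform closeness of characters on
  \<open>C n\<close> controls that part, and off \<open>C n\<close> two characters differ by at most
  2.\<close>

lemma openin_fourier:
  assumes h: "integrable \<nu> h" and "open S"
  shows "openin dual_topology {\<xi>\<in>dual_chars. fourier \<nu> h \<xi> \<in> S}"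
proof (subst openin_subopen, intro ballI)
  fix \<gamma> assume "\<gamma> \<in> {\<xi>\<in>dual_chars. fourier \<nu> h \<xi> \<in> S}"
  then have \<gamma>: "\<gamma> \<in> dual_chars" "fourier \<nu> h \<gamma> \<in> S" by auto
  note [measurable] = borel_measurable_integrable[OF h]
  obtain e where e: "e > 0" "ball (fourier \<nu> h \<gamma>) e \<subseteq> S"
    using \<open>open S\<close> \<gamma> by (meson open_contains_ball)
  obtain C :: "nat \<Rightarrow> 'g set" where C: "incseq C" "\<And>n. compact (C n)" "(\<Union>n. C n) = UNIV"
    using exhaustion by blast
  have [measurable]: "C n \<in> sets borel" for n using C(2) by (rule borel_compact)
  have "(\<lambda>n. \<integral>u. indicator (- C n) u * cmod (h u) \<partial>\<nu>) \<longlonglongrightarrow> (\<integral>u. 0 \<partial>\<nu>)"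
  proof (rule integral_dominated_convergence[where w = "\<lambda>u. cmod (h u)"])
    show "AE u in \<nu>. (\<lambda>n. indicator (- C n) u * cmod (h u)) \<longlonglongrightarrow> 0"
    proof (rule AE_I2)
      fix u
      obtain n where n: "u \<in> C n" using C(3) by auto
      have "\<forall>\<^sub>F m in sequentially. indicator (- C m) u * cmod (h u) = 0"
        using eventually_ge_at_top[of n]
        by eventually_elim (use n C(1) in \<open>auto simp: incseq_def indicator_def\<close>)
      then show "(\<lambda>n. indicator (- C n) u * cmod (h u)) \<longlonglongrightarrow> 0"
        by (rule tendsto_eventually)
    qed
  qed (use h in \<open>auto simp: indicator_def\<close>)
  then have "\<forall>\<^sub>F n in sequentially. (\<integral>u. indicator (- C n) u * cmod (h u) \<partial>\<nu>) < e / 4"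
    using e(1) by (intro order_tendstoD(2)) auto
  then obtain n where n: "(\<integral>u. indicator (- C n) u * cmod (h u) \<partial>\<nu>) < e / 4"
    by (meson eventually_happens' sequentially_bot)
  define I where "I = (\<integral>u. cmod (h u) \<partial>\<nu>)"
  have I: "I \<ge> 0" unfolding I_def by simp
  \<comment> \<open>The compact part contributes at most \<open>e / 2\<close>, the tail less than 2
    * e/4; the summand 1 prevents division by zero when h vanishes.\<close>
  define \<delta> where "\<delta> = e / (2 * (I + 1))"
  have \<delta>: "\<delta> > 0" using e I by (simp add: \<delta>_def)
  have "\<delta> * I \<le> e / 2" using e I by (simp add: \<delta>_def field_simps)
  have close: "cmod (fourier \<nu> h \<psi> - fourier \<nu> h \<gamma>) < e"
    if \<psi>: "\<psi> \<in> dual_chars" "\<forall>x\<in>C n. cmod (\<psi> x - \<gamma> x) < \<delta>" for \<psi>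
  proof -
    have i: "integrable \<nu> (\<lambda>u. h u * cnj (\<psi> u))" "integrable \<nu> (\<lambda>u. h u * cnj (\<gamma> u))"
      using fourier_integrable[OF h] \<psi> \<gamma> by auto
    have i2: "integrable \<nu> (\<lambda>u. \<delta> * cmod (h u))" "integrable \<nu> (\<lambda>u. 2 * (indicator (- C n) u * cmod (h u)))"
      using h by (auto intro!: integrable_real_mult_indicator[where 'a = 'g, simplified mult.commute] simp: mult.commute[of "indicator _ _ :: real"])
    have "cmod (fourier \<nu> h \<psi> - fourier \<nu> h \<gamma>) = cmod (\<integral>u. h u * cnj (\<psi> u) - h u * cnj (\<gamma> u) \<partial>\<nu>)"
      unfolding fourier_def using i by simp
    also have "\<dots> \<le> (\<integral>u. cmod (h u * cnj (\<psi> u) - h u * cnj (\<gamma> u)) \<partial>\<nu>)"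
      by (rule integral_norm_bound)
    also have "\<dots> \<le> (\<integral>u. \<delta> * cmod (h u) + 2 * (indicator (- C n) u * cmod (h u)) \<partial>\<nu>)"
    proof (rule integral_mono)
      fix u
      have eq: "cmod (h u * cnj (\<psi> u) - h u * cnj (\<gamma> u)) = cmod (h u) * cmod (\<psi> u - \<gamma> u)"
        by (metis complex_cnj_diff complex_mod_cnj norm_mult right_diff_distrib)
      have "cmod (\<psi> u - \<gamma> u) \<le> \<delta> + 2 * indicator (- C n) u"
      proof (cases "u \<in> C n")
        case True
        then show ?thesis using \<psi>(2) by (auto intro: less_imp_le)
      next
        case False
        have "cmod (\<psi> u - \<gamma> u) \<le> cmod (\<psi> u) + cmod (\<gamma> u)" by (rule norm_triangle_ineq4)
        then show ?thesis using False \<delta> by (simp add: char_norm[OF \<psi>(1)] char_norm[OF \<gamma>(1)])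
      qed
      from mult_left_mono[OF this, of "cmod (h u)"]
      show "cmod (h u * cnj (\<psi> u) - h u * cnj (\<gamma> u)) \<le> \<delta> * cmod (h u) + 2 * (indicator (- C n) u * cmod (h u))"
        unfolding eq by (simp add: algebra_simps)
    qed (use i i2 in auto)
    also have "\<dots> = \<delta> * I + 2 * (\<integral>u. indicator (- C n) u * cmod (h u) \<partial>\<nu>)"
      unfolding I_def by (subst Bochner_Integration.integral_add[OF i2]) simp
    also have "\<dots> < e" using n \<open>\<delta> * I \<le> e / 2\<close> by linarith
    finally show ?thesis .
  qed
  show "\<exists>T. openin dual_topology T \<and> \<gamma> \<in> T \<and> T \<subseteq> {\<xi>\<in>dual_chars. fourier \<nu> h \<xi> \<in> S}"
  proof (intro exI conjI)
    show "openin dual_topology {\<psi>\<in>dual_chars. \<forall>x\<in>C n. cmod (\<psi> x - \<gamma> x) < \<delta>}"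
      by (rule openin_dual_topology_basic[OF \<gamma>(1) C(2) \<delta>])
    show "\<gamma> \<in> {\<psi>\<in>dual_chars. \<forall>x\<in>C n. cmod (\<psi> x - \<gamma> x) < \<delta>}" using \<gamma> \<delta> by simp
    show "{\<psi>\<in>dual_chars. \<forall>x\<in>C n. cmod (\<psi> x - \<gamma> x) < \<delta>} \<subseteq> {\<xi>\<in>dual_chars. fourier \<nu> h \<xi> \<in> S}"
      using close e(2) by (auto simp: dist_norm norm_minus_commute subset_iff)
  qed
qed

lemma fourier_param_measurable:
  assumes [measurable]: "case_prod k \<in> borel_measurable (M \<Otimes>\<^sub>M borel)"
  shows "(\<lambda>(\<xi>, v). fourier \<nu> (k v) \<xi>) \<in> borel_measurable (\<nu>h \<Otimes>\<^sub>M M)"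
proof -
  have [measurable]: "(\<lambda>x. (fst (fst x) :: 'g \<Rightarrow> complex) (snd x)) \<in> borel_measurable ((\<nu>h \<Otimes>\<^sub>M M) \<Otimes>\<^sub>M borel)"
    by (rule eval_compose_measurable) auto
  have [measurable]: "(\<lambda>x. k (snd (fst x)) (snd x)) \<in> borel_measurable ((\<nu>h \<Otimes>\<^sub>M M) \<Otimes>\<^sub>M borel)"
    using measurable_compose[OF _ assms, of "\<lambda>x. (snd (fst x), snd x)" "(\<nu>h \<Otimes>\<^sub>M M) \<Otimes>\<^sub>M borel"] by simp
  have "(\<lambda>x. \<integral>u. k (snd x) u * cnj (fst x u) \<partial>\<nu>) \<in> borel_measurable (\<nu>h \<Otimes>\<^sub>M M)"
    by (rule borel_measurable_lebesgue_integral) (simp add: case_prod_beta')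
  then show ?thesis by (simp add: fourier_def case_prod_beta')
qed

lemma indicator_integrable:
  assumes "B \<in> sets borel" "emeasure \<nu> B < \<infinity>"
  shows "integrable \<nu> (indicator B :: 'g \<Rightarrow> complex)" "square_integrable \<nu> (indicator B)"
proof -
  have real: "integrable \<nu> (indicator B :: 'g \<Rightarrow> real)"
    using assms by (intro integrable_real_indicator) (auto simp: sets_haar)
  have "(\<lambda>u. complex_of_real (indicator B u)) = indicator B"
    by (auto simp: indicator_def)
  then show 1: "integrable \<nu> (indicator B :: 'g \<Rightarrow> complex)"
    using integrable_of_real[OF real, where 'a = complex] by simp
  have "(\<lambda>x. (cmod (indicator B x))\<^sup>2) = (indicator B :: 'g \<Rightarrow> real)"
    by (auto simp: indicator_def)
  then show "square_integrable \<nu> (indicator B)"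
    unfolding square_integrable_def using real 1 by auto
qed

text \<open>A character is close to 1 near 0, so its integral over a small ball has positive real
  part. Countably many transforms without common zero replace a topological exhaustion of the dual
  group, and later they localize an integral identity.\<close>

lemma test_sets:
  obtains B :: "nat \<Rightarrow> 'g set"
  where "\<And>j. B j \<in> sets borel" "\<And>j. emeasure \<nu> (B j) < \<infinity>"
    "\<And>\<xi>. \<xi> \<in> dual_chars \<Longrightarrow> \<exists>j. fourier \<nu> (indicator (B j)) \<xi> \<noteq> 0"
proof -
  obtain r where r: "r > 0" "emeasure \<nu> (ball 0 r) < \<infinity>" using finite_ball by blast
  \<comment> \<open>The radius bound \<open>r\<close> keeps the measure finite; the balls shrink to
    0.\<close>
  define B where "B j = ball (0::'g) (min r (1 / real (Suc j)))" for j
  have B_sets [measurable]: "B j \<in> sets borel" for j unfolding B_def by simp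
  have B_fin: "emeasure \<nu> (B j) < \<infinity>" for j
  proof (rule le_less_trans[OF emeasure_mono r(2)])
    show "B j \<subseteq> ball 0 r" by (auto simp: B_def)
  qed (simp add: sets_haar)
  have "\<exists>j. fourier \<nu> (indicator (B j)) \<xi> \<noteq> 0" if \<xi>: "\<xi> \<in> dual_chars" for \<xi>
  proof -
    have "isCont \<xi> 0" using char_continuous[OF \<xi>] by (simp add: continuous_on_eq_continuous_at)
    then obtain \<delta> where \<delta>: "\<delta> > 0" "\<And>u. dist u 0 < \<delta> \<Longrightarrow> dist (\<xi> u) (\<xi> 0) < 1 / 2"
      unfolding continuous_at_eps_delta by (metis half_gt_zero zero_less_one)
    obtain j where j: "1 / real (Suc j) < \<delta>" using \<delta> nat_approx_posE by blast
    have Re: "1 / 2 \<le> Re (\<xi> u)" if "u \<in> B j" for u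
    proof -
      have "cmod (\<xi> u - 1) < 1 / 2"
        using \<delta>(2)[of u] that j by (simp add: B_def char_zero[OF \<xi>] dist_norm[symmetric] dist_commute)
      then show ?thesis using abs_Re_le_cmod[of "\<xi> u - 1"] by simp
    qed
    have ind: "integrable \<nu> (indicator (B j) :: 'g \<Rightarrow> complex)"
      by (rule indicator_integrable[OF B_sets B_fin])
    have "0 \<in> B j" using r by (simp add: B_def)
    moreover have "open (B j)" by (simp add: B_def)
    ultimately have "0 < emeasure \<nu> (B j)" using emeasure_open_pos by blast
    then have pos: "0 < measure \<nu> (B j)"
      using B_fin[of j] by (simp add: measure_def enn2real_positive_iff less_top)
    have "measure \<nu> (B j) / 2 = (\<integral>u. indicator (B j) u * (1 / 2) \<partial>\<nu>)"
      by simp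
    also have "\<dots> \<le> (\<integral>u. Re (indicator (B j) u * cnj (\<xi> u)) \<partial>\<nu>)"
    proof (rule integral_mono)
      show "integrable \<nu> (\<lambda>u. indicator (B j) u * (1 / 2 :: real))"
        using B_fin[of j] by (intro integrable_mult_left) (auto simp: sets_haar)
      show "integrable \<nu> (\<lambda>u. Re (indicator (B j) u * cnj (\<xi> u)))"
        by (rule integrable_bounded_linear[OF bounded_linear_Re fourier_integrable[OF ind \<xi>]])
      show "indicator (B j) u * (1 / 2) \<le> Re (indicator (B j) u * cnj (\<xi> u))" for u
        using Re[of u] by (simp add: indicator_def)
    qed
    also have "\<dots> = Re (fourier \<nu> (indicator (B j)) \<xi>)"
      unfolding fourier_def
      by (rule integral_bounded_linear[OF bounded_linear_Re fourier_integrable[OF ind \<xi>]])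
    finally show ?thesis using pos by (intro exI[of _ j]) auto
  qed
  then show ?thesis using that[of B] B_sets B_fin by blast
qed

section \<open>Plancherel on integrable and square-integrable functions\<close>

lemma plancherel:
  assumes "integrable \<nu> h" "square_integrable \<nu> h"
  shows "square_integrable \<nu>h (fourier \<nu> h)"
    and "(\<integral>\<xi>. (cmod (fourier \<nu> h \<xi>))\<^sup>2 \<partial>\<nu>h) = (\<integral>u. (cmod (h u))\<^sup>2 \<partial>\<nu>)"
  using planch assms unfolding plancherel_normalized_def by auto

text \<open>The transforms of the test sets are square integrable by Plancherel, so by Markov's
  inequality each superlevel set \<open>A j m\<close> has finite measure. These sets cover the dual
  group since the transforms have no common zero.\<close>

sublocale dual: sigma_finite_measure \<nu>h
proof
  obtain B :: "nat \<Rightarrow> 'g set" where B: "\<And>j. B j \<in> sets borel" "\<And>j. emeasure \<nu> (B j) < \<infinity>"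
    "\<And>\<xi>. \<xi> \<in> dual_chars \<Longrightarrow> \<exists>j. fourier \<nu> (indicator (B j)) \<xi> \<noteq> 0"
    using test_sets by blast
  let ?F = "\<lambda>j. fourier \<nu> (indicator (B j))"
  have F: "square_integrable \<nu>h (?F j)" for j
    using plancherel(1) indicator_integrable[OF B(1,2)] by blast
  note [measurable] = F[THEN square_integrable_measurable]
  define A where "A j m = {\<xi>\<in>space \<nu>h. 1 \<le> ennreal (real (Suc m)) * ennreal ((cmod (?F j \<xi>))\<^sup>2)}" for j m
  have A_sets: "A j m \<in> sets \<nu>h" for j m unfolding A_def by measurable
  have "emeasure \<nu>h (A j m) \<le> ennreal (real (Suc m)) * (\<integral>\<^sup>+\<xi>. ennreal ((cmod (?F j \<xi>))\<^sup>2) * indicator (space \<nu>h) \<xi> \<partial>\<nu>h)" for j m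
    unfolding A_def by (rule nn_integral_Markov_inequality) auto
  also have "ennreal (real (Suc m)) * (\<integral>\<^sup>+\<xi>. ennreal ((cmod (?F j \<xi>))\<^sup>2) * indicator (space \<nu>h) \<xi> \<partial>\<nu>h)
      = ennreal (real (Suc m)) * (\<integral>\<^sup>+\<xi>. ennreal ((cmod (?F j \<xi>))\<^sup>2) \<partial>\<nu>h)" for j m
    by (intro arg_cong2[where f = "(*)"] refl nn_integral_cong) simp
  also have "\<dots> j m < \<infinity>" for j m
    unfolding nn_integral_square[OF F] by (simp add: ennreal_mult_less_top)
  finally have A_fin: "emeasure \<nu>h (A j m) < \<infinity>" for j m .
  have cover: "\<exists>j m. \<xi> \<in> A j m" if "\<xi> \<in> space \<nu>h" for \<xi>
  proof -
    obtain j where "?F j \<xi> \<noteq> 0" using B(3) \<open>\<xi> \<in> space \<nu>h\<close> by (auto simp: space_dual)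
    then obtain m where "1 / real (Suc m) < (cmod (?F j \<xi>))\<^sup>2"
      using nat_approx_posE[of "(cmod (?F j \<xi>))\<^sup>2"] by auto
    then have "1 \<le> real (Suc m) * (cmod (?F j \<xi>))\<^sup>2"
      by (simp add: field_simps)
    then have "1 \<le> ennreal (real (Suc m)) * ennreal ((cmod (?F j \<xi>))\<^sup>2)"
      by (subst ennreal_mult[symmetric]) simp_all
    then have "\<xi> \<in> A j m" using that by (simp add: A_def)
    then show ?thesis by blast
  qed
  show "\<exists>A. countable A \<and> A \<subseteq> sets \<nu>h \<and> \<Union>A = space \<nu>h \<and> (\<forall>a\<in>A. emeasure \<nu>h a \<noteq> \<infinity>)"
  proof (intro exI[of _ "range (\<lambda>(j, m). A j m)"] conjI)
    show "\<Union>(range (\<lambda>(j, m). A j m)) = space \<nu>h"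
      using cover sets.sets_into_space[OF A_sets] by auto
  qed (use A_sets A_fin in \<open>auto simp: less_top\<close>)
qed

lemma plancherel_inner:
  assumes "integrable \<nu> h" "square_integrable \<nu> h" "integrable \<nu> k" "square_integrable \<nu> k"
  shows "(\<integral>\<xi>. fourier \<nu> h \<xi> * cnj (fourier \<nu> k \<xi>) \<partial>\<nu>h) = (\<integral>u. h u * cnj (k u) \<partial>\<nu>)"
proof (rule inner_eq_if_norm_eq)
  fix c
  have "integrable \<nu> (\<lambda>u. h u + c * k u)" using assms by simp
  moreover have "square_integrable \<nu> (\<lambda>u. h u + c * k u)"
    using assms by (intro square_integrable_add square_integrable_cmult)
  ultimately have "(\<integral>\<xi>. (cmod (fourier \<nu> (\<lambda>u. h u + c * k u) \<xi>))\<^sup>2 \<partial>\<nu>h) = (\<integral>u. (cmod (h u + c * k u))\<^sup>2 \<partial>\<nu>)"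
    by (rule plancherel(2))
  moreover have "(\<integral>\<xi>. (cmod (fourier \<nu> (\<lambda>u. h u + c * k u) \<xi>))\<^sup>2 \<partial>\<nu>h)
      = (\<integral>\<xi>. (cmod (fourier \<nu> h \<xi> + c * fourier \<nu> k \<xi>))\<^sup>2 \<partial>\<nu>h)"
    by (intro Bochner_Integration.integral_cong)
       (use assms in \<open>auto simp: fourier_lincomb space_dual\<close>)
  ultimately show "(\<integral>\<xi>. (cmod (fourier \<nu> h \<xi> + c * fourier \<nu> k \<xi>))\<^sup>2 \<partial>\<nu>h) = (\<integral>u. (cmod (h u + c * k u))\<^sup>2 \<partial>\<nu>)"
    by simp
qed (use assms plancherel in auto)

text \<open>This produces functions with nonnegative Fourier transform to which Plancherel applies:
  the autocorrelation of a set of finite measure is integrable and bounded, hence square integrable.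
  Such transforms serve as weights on the dual group in
  \<open>qnorm2_eq_1_if_nonzero\<close>.\<close>

lemma autocorrelation:
  assumes B [measurable]: "B \<in> sets borel" and fin: "emeasure \<nu> B < \<infinity>"
  defines "h \<equiv> \<lambda>u. \<integral>s. indicator B (u + s) * indicator B s \<partial>\<nu> :: complex"
  shows "integrable \<nu> h" "square_integrable \<nu> h"
    and "\<And>\<xi>. \<xi> \<in> dual_chars \<Longrightarrow>
      fourier \<nu> h \<xi> = complex_of_real ((cmod (fourier \<nu> (indicator B) \<xi>))\<^sup>2)"
proof -
  interpret PP: pair_sigma_finite \<nu> \<nu> ..
  let ?g = "indicator B :: 'g \<Rightarrow> complex"
  have g: "integrable \<nu> ?g" by (rule indicator_integrable(1)[OF B fin])
  have int: "integrable (\<nu> \<Otimes>\<^sub>M \<nu>) (\<lambda>(u, s). ?g (u + s) * ?g s)"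
  proof (subst integrable_iff_bounded, intro conjI)
    show "(\<lambda>(u, s). ?g (u + s) * ?g s) \<in> borel_measurable (\<nu> \<Otimes>\<^sub>M \<nu>)" by measurable
    have "(\<integral>\<^sup>+p. ennreal (cmod (case p of (u, s) \<Rightarrow> ?g (u + s) * ?g s)) \<partial>(\<nu> \<Otimes>\<^sub>M \<nu>))
      = (\<integral>\<^sup>+p. (case p of (u, s) \<Rightarrow> indicator B (u + s) * indicator B s) \<partial>(\<nu> \<Otimes>\<^sub>M \<nu>))"
      by (intro nn_integral_cong) (simp add: indicator_def split: prod.split)
    also have "\<dots> = (\<integral>\<^sup>+s. \<integral>\<^sup>+u. indicator B (u + s) * indicator B s \<partial>\<nu> \<partial>\<nu>)"
      by (subst PP.nn_integral_snd[symmetric]) auto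
    also have "\<dots> = (\<integral>\<^sup>+s. (\<integral>\<^sup>+u. indicator B (u + s) \<partial>\<nu>) * indicator B s \<partial>\<nu>)"
      by (simp add: nn_integral_multc)
    also have "\<dots> = (\<integral>\<^sup>+s. emeasure \<nu> B * indicator B s \<partial>\<nu>)"
      by (subst nn_integral_translate) (auto simp: sets_haar)
    also have "\<dots> = emeasure \<nu> B * emeasure \<nu> B"
      by (simp add: nn_integral_cmult sets_haar)
    also have "\<dots> < \<infinity>" using fin by (simp add: ennreal_mult_less_top)
    finally show "(\<integral>\<^sup>+p. ennreal (cmod (case p of (u, s) \<Rightarrow> ?g (u + s) * ?g s)) \<partial>(\<nu> \<Otimes>\<^sub>M \<nu>)) < \<infinity>" .
  qed
  show h: "integrable \<nu> h"
    unfolding h_def using PP.integrable_fst[OF int] .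
  have bound: "cmod (h u) \<le> measure \<nu> B" for u
  proof -
    have "cmod (h u) \<le> (\<integral>s. indicator B s \<partial>\<nu>)"
      unfolding h_def
    proof (rule order_trans[OF integral_norm_bound integral_mono])
      show "integrable \<nu> (indicator B :: 'g \<Rightarrow> real)"
        using fin by (auto simp: sets_haar)
      show "integrable \<nu> (\<lambda>s. norm (?g (u + s) * ?g s))"
        by (rule integrable_norm, rule Bochner_Integration.integrable_bound[OF g]) (auto simp: indicator_def)
    qed (auto simp: indicator_def)
    then show ?thesis by simp
  qed
  show "square_integrable \<nu> h"
    unfolding square_integrable_def
  proof
    show m: "h \<in> borel_measurable \<nu>" using h by auto
    show "integrable \<nu> (\<lambda>u. (cmod (h u))\<^sup>2)"
    proof (rule Bochner_Integration.integrable_bound)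
      show "integrable \<nu> (\<lambda>u. measure \<nu> B * cmod (h u))" using h by simp
      show "AE u in \<nu>. norm ((cmod (h u))\<^sup>2) \<le> norm (measure \<nu> B * cmod (h u))"
        using bound by (auto simp: power2_eq_square intro!: mult_right_mono)
    qed (use m in simp)
  qed
  fix \<xi> :: "'g \<Rightarrow> complex" assume \<xi>: "\<xi> \<in> dual_chars"
  have [measurable]: "\<xi> \<in> borel_measurable borel" using \<xi> by (rule char_measurable)
  have int': "integrable (\<nu> \<Otimes>\<^sub>M \<nu>) (\<lambda>(u, s). ?g (u + s) * ?g s * cnj (\<xi> u))"
    by (rule Bochner_Integration.integrable_bound[OF int])
       (auto simp: norm_mult char_norm[OF \<xi>] split: prod.split)
  have "fourier \<nu> h \<xi> = (\<integral>u. \<integral>s. ?g (u + s) * ?g s * cnj (\<xi> u) \<partial>\<nu> \<partial>\<nu>)"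
    unfolding fourier_def h_def by simp
  also have "\<dots> = (\<integral>s. \<integral>u. ?g (u + s) * ?g s * cnj (\<xi> u) \<partial>\<nu> \<partial>\<nu>)"
    by (rule PP.Fubini_integral[OF int', symmetric])
  also have "\<dots> = (\<integral>s. fourier \<nu> ?g \<xi> * cnj (?g s * cnj (\<xi> s)) \<partial>\<nu>)"
  proof (rule Bochner_Integration.integral_cong[OF refl])
    fix s
    \<comment> \<open>With t = u + s, the character at t - s splits into a factor in t and a factor
      in s, and the double integral becomes a product.\<close>
    have "(\<integral>u. ?g (u + s) * ?g s * cnj (\<xi> u) \<partial>\<nu>)
        = (\<integral>u. (\<lambda>t. ?g t * ?g s * cnj (\<xi> (t - s))) (u + s) \<partial>\<nu>)"
      by simp
    also have "\<dots> = (\<integral>t. ?g t * ?g s * cnj (\<xi> (t - s)) \<partial>\<nu>)"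
      by (rule integral_translate) measurable
    also have "\<dots> = (\<integral>t. (?g t * cnj (\<xi> t)) * cnj (?g s * cnj (\<xi> s)) \<partial>\<nu>)"
      by (intro Bochner_Integration.integral_cong) (auto simp: char_diff[OF \<xi>] indicator_def)
    also have "\<dots> = fourier \<nu> ?g \<xi> * cnj (?g s * cnj (\<xi> s))"
      by (simp add: fourier_def)
    finally show "(\<integral>u. ?g (u + s) * ?g s * cnj (\<xi> u) \<partial>\<nu>) = fourier \<nu> ?g \<xi> * cnj (?g s * cnj (\<xi> s))" .
  qed
  also have "\<dots> = fourier \<nu> ?g \<xi> * cnj (fourier \<nu> ?g \<xi>)"
    unfolding fourier_def by (simp only: integral_mult_right_zero Bochner_Integration.integral_cnj)
  also have "\<dots> = complex_of_real ((cmod (fourier \<nu> ?g \<xi>))\<^sup>2)"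
    by (rule complex_norm_square[symmetric])
  finally show "fourier \<nu> h \<xi> = complex_of_real ((cmod (fourier \<nu> ?g \<xi>))\<^sup>2)" .
qed

section \<open>The Fourier-Plancherel transform as an L2 limit\<close>

lemma is_FP_fourier:
  assumes "integrable \<nu> h" "square_integrable \<nu> h"
  shows "is_FP \<nu> \<nu>h h (fourier \<nu> h)"
  unfolding is_FP_def using assms plancherel(1)
  by (intro conjI exI[of _ "\<lambda>_. h"]) (auto simp: L2dist2_def)

text \<open>The perturbation inequality is applied twice with the same \<open>e\<close>, comparing g
  with the transform of the approximant \<open>hn n\<close>, and \<open>hn n\<close> with h;
  Plancherel connects the two. Then n tends to infinity, and \<open>e\<close> to 0.\<close>

lemma is_FP_norm_le:
  assumes FP: "is_FP \<nu> \<nu>h h g" and h: "square_integrable \<nu> h"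
  shows "(\<integral>\<xi>. (cmod (g \<xi>))\<^sup>2 \<partial>\<nu>h) \<le> (\<integral>u. (cmod (h u))\<^sup>2 \<partial>\<nu>)"
proof -
  obtain hn where g: "square_integrable \<nu>h g"
    and hn: "\<And>n. integrable \<nu> (hn n)" "\<And>n. square_integrable \<nu> (hn n)"
    and lim: "(\<lambda>n. L2dist2 \<nu> (hn n) h) \<longlonglongrightarrow> 0" "(\<lambda>n. L2dist2 \<nu>h (fourier \<nu> (hn n)) g) \<longlonglongrightarrow> 0"
    using FP unfolding is_FP_def by blast
  let ?a = "\<integral>u. (cmod (h u))\<^sup>2 \<partial>\<nu>"
  have e: "(\<integral>\<xi>. (cmod (g \<xi>))\<^sup>2 \<partial>\<nu>h) \<le> (1 + e) * ((1 + e) * ?a)" if "e > 0" for e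
  proof (rule LIMSEQ_le_const)
    show "(\<lambda>n. (1 + e) * ((1 + e) * ?a + (1 + 1 / e) * L2dist2 \<nu> (hn n) h)
        + (1 + 1 / e) * L2dist2 \<nu>h (fourier \<nu> (hn n)) g) \<longlonglongrightarrow> (1 + e) * ((1 + e) * ?a)"
      by (rule tendsto_eq_intros lim refl)+ simp
    have "(\<integral>\<xi>. (cmod (g \<xi>))\<^sup>2 \<partial>\<nu>h) \<le> (1 + e) * ((1 + e) * ?a + (1 + 1 / e) * L2dist2 \<nu> (hn n) h)
        + (1 + 1 / e) * L2dist2 \<nu>h (fourier \<nu> (hn n)) g" for n
    proof -
      have "(\<integral>\<xi>. (cmod (g \<xi>))\<^sup>2 \<partial>\<nu>h) \<le> (1 + e) * (\<integral>u. (cmod (hn n u))\<^sup>2 \<partial>\<nu>)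
          + (1 + 1 / e) * L2dist2 \<nu>h (fourier \<nu> (hn n)) g"
        using integral_square_le_perturbed[OF g plancherel(1)[OF hn] \<open>e > 0\<close>]
        unfolding plancherel(2)[OF hn] .
      moreover have "(1 + e) * (\<integral>u. (cmod (hn n u))\<^sup>2 \<partial>\<nu>) \<le> (1 + e) * ((1 + e) * ?a + (1 + 1 / e) * L2dist2 \<nu> (hn n) h)"
        using integral_square_le_perturbed[OF hn(2) h \<open>e > 0\<close>] \<open>e > 0\<close>
        by (intro mult_left_mono) (auto simp: L2dist2_commute)
      ultimately show ?thesis by linarith
    qed
    then show "\<exists>N. \<forall>n\<ge>N. (\<integral>\<xi>. (cmod (g \<xi>))\<^sup>2 \<partial>\<nu>h) \<le> (1 + e) * ((1 + e) * ?a + (1 + 1 / e) * L2dist2 \<nu> (hn n) h)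
        + (1 + 1 / e) * L2dist2 \<nu>h (fourier \<nu> (hn n)) g" by blast
  qed
  show ?thesis
  proof (rule tendsto_lowerbound)
    have "((\<lambda>e. (1 + e) * ((1 + e) * ?a)) \<longlongrightarrow> (1 + 0) * ((1 + 0) * ?a)) (at_right 0)"
      by (intro tendsto_intros)
    then show "((\<lambda>e. (1 + e) * ((1 + e) * ?a)) \<longlongrightarrow> ?a) (at_right 0)" by simp
    show "\<forall>\<^sub>F e in at_right 0. (\<integral>\<xi>. (cmod (g \<xi>))\<^sup>2 \<partial>\<nu>h) \<le> (1 + e) * ((1 + e) * ?a)"
      using eventually_at_right_less by eventually_elim (rule e)
  qed simp
qed

lemma is_FP_lincomb:
  assumes FP: "is_FP \<nu> \<nu>h h g" "is_FP \<nu> \<nu>h h' g'"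
    and h: "square_integrable \<nu> h" "square_integrable \<nu> h'"
  shows "is_FP \<nu> \<nu>h (\<lambda>u. h u + c * h' u) (\<lambda>\<xi>. g \<xi> + c * g' \<xi>)"
proof -
  obtain hn where g: "square_integrable \<nu>h g"
    and hn: "\<And>n. integrable \<nu> (hn n)" "\<And>n. square_integrable \<nu> (hn n)"
    and lim: "(\<lambda>n. L2dist2 \<nu> (hn n) h) \<longlonglongrightarrow> 0" "(\<lambda>n. L2dist2 \<nu>h (fourier \<nu> (hn n)) g) \<longlonglongrightarrow> 0"
    using FP(1) unfolding is_FP_def by blast
  obtain hn' where g': "square_integrable \<nu>h g'"
    and hn': "\<And>n. integrable \<nu> (hn' n)" "\<And>n. square_integrable \<nu> (hn' n)"
    and lim': "(\<lambda>n. L2dist2 \<nu> (hn' n) h') \<longlonglongrightarrow> 0" "(\<lambda>n. L2dist2 \<nu>h (fourier \<nu> (hn' n)) g') \<longlonglongrightarrow> 0"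
    using FP(2) unfolding is_FP_def by blast
  show ?thesis
    unfolding is_FP_def
  proof (intro conjI exI[of _ "\<lambda>n u. hn n u + c * hn' n u"] allI)
    show "square_integrable \<nu>h (\<lambda>\<xi>. g \<xi> + c * g' \<xi>)"
      by (intro square_integrable_add square_integrable_cmult g g')
    show "integrable \<nu> (\<lambda>u. hn n u + c * hn' n u)" for n using hn hn' by simp
    show "square_integrable \<nu> (\<lambda>u. hn n u + c * hn' n u)" for n
      by (intro square_integrable_add square_integrable_cmult hn hn')
    show "(\<lambda>n. L2dist2 \<nu> (\<lambda>u. hn n u + c * hn' n u) (\<lambda>u. h u + c * h' u)) \<longlonglongrightarrow> 0"
      by (rule L2dist2_lincomb_tendsto[OF lim(1) lim'(1)]) (intro hn hn' h)+
    have "(\<lambda>n. L2dist2 \<nu>h (\<lambda>\<xi>. fourier \<nu> (hn n) \<xi> + c * fourier \<nu> (hn' n) \<xi>) (\<lambda>\<xi>. g \<xi> + c * g' \<xi>)) \<longlonglongrightarrow> 0"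
      by (rule L2dist2_lincomb_tendsto[OF lim(2) lim'(2)]) (intro plancherel hn hn' g g')+
    moreover have "L2dist2 \<nu>h (\<lambda>\<xi>. fourier \<nu> (hn n) \<xi> + c * fourier \<nu> (hn' n) \<xi>) (\<lambda>\<xi>. g \<xi> + c * g' \<xi>)
        = L2dist2 \<nu>h (fourier \<nu> (\<lambda>u. hn n u + c * hn' n u)) (\<lambda>\<xi>. g \<xi> + c * g' \<xi>)" for n
      unfolding L2dist2_def
      by (intro Bochner_Integration.integral_cong) (auto simp: fourier_lincomb hn hn' space_dual)
    ultimately show "(\<lambda>n. L2dist2 \<nu>h (fourier \<nu> (\<lambda>u. hn n u + c * hn' n u)) (\<lambda>\<xi>. g \<xi> + c * g' \<xi>)) \<longlonglongrightarrow> 0"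
      by simp
  qed
qed

lemma is_FP_unique:
  assumes "is_FP \<nu> \<nu>h h g" "is_FP \<nu> \<nu>h h g'" "square_integrable \<nu> h"
  shows "AE \<xi> in \<nu>h. g \<xi> = g' \<xi>"
proof (rule AE_eq_if_L2dist2_zero)
  show "square_integrable \<nu>h g" "square_integrable \<nu>h g'"
    using assms unfolding is_FP_def by auto
  \<comment> \<open>The difference of two transforms of h is a transform of 0, so its norm is at
    most 0.\<close>
  have "is_FP \<nu> \<nu>h (\<lambda>u. 0) (\<lambda>\<xi>. g \<xi> - g' \<xi>)"
    using is_FP_lincomb[OF assms(1,2,3,3), of "-1"] by simp
  then have "L2dist2 \<nu>h g g' \<le> 0"
    using is_FP_norm_le[of "\<lambda>u. 0"] unfolding L2dist2_def by (simp add: square_integrable_def)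
  then show "L2dist2 \<nu>h g g' = 0" using L2dist2_nonneg[of \<nu>h g g'] by linarith
qed

end

section \<open>The Fourier--Plancherel transform in the first variable\<close>

lemma (in pair_sigma_finite) square_integrable_sections:
  assumes "square_integrable (M1 \<Otimes>\<^sub>M M2) f"
  shows "AE y in M2. square_integrable M1 (\<lambda>x. f (x, y))"
    and "AE x in M1. square_integrable M2 (\<lambda>y. f (x, y))"
proof -
  note [measurable] = square_integrable_measurable[OF assms]
  have int: "integrable (M1 \<Otimes>\<^sub>M M2) (\<lambda>(x, y). (cmod (f (x, y)))\<^sup>2)"
    using assms by (simp add: square_integrable_def case_prod_unfold)
  show "AE y in M2. square_integrable M1 (\<lambda>x. f (x, y))"
    using AE_integrable_snd[OF int] AE_space[of M2]
    by eventually_elim (simp add: square_integrable_def)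
  show "AE x in M1. square_integrable M2 (\<lambda>y. f (x, y))"
    using AE_integrable_fst[OF int] AE_space[of M1]
    by eventually_elim (simp add: square_integrable_def)
qed

locale plancherel_product = plancherel_pair \<nu> \<nu>h
  for \<nu> :: "'g::{ab_group_add, metric_space} measure" and \<nu>h +
  fixes lam :: "'y measure"
  assumes lam_sigma_finite: "sigma_finite_measure lam" and space_lam: "space lam = UNIV"
begin

sublocale lam: sigma_finite_measure lam by (rule lam_sigma_finite)
sublocale P: pair_sigma_finite \<nu> lam ..
sublocale Q: pair_sigma_finite \<nu>h lam ..

text \<open>For each v the slice is cut off to a compact set whose index \<open>k j v\<close>
  depends measurably on v and makes the lost squared norm at most 8^-j. The transforms of the
  cut-off slices are then jointly measurable and, by Plancherel, Cauchy at a rate independent of v,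
  so their pointwise limit is a jointly measurable transform.\<close>

lemma is_FI_exists:
  assumes f: "square_integrable (\<nu> \<Otimes>\<^sub>M lam) f"
  shows "\<exists>\<Phi>. is_FI \<nu> \<nu>h lam f \<Phi>"
proof -
  have f_meas: "f \<in> borel_measurable (borel \<Otimes>\<^sub>M lam)"
    using square_integrable_measurable[OF f]
    by (simp cong: measurable_cong_sets sets_pair_measure_cong add: sets_haar)
  note [measurable] = f_meas
  have [measurable]: "(\<lambda>u. f (u, v)) \<in> borel_measurable borel" for v
    by (rule measurable_compose[OF measurable_Pair2' f_meas]) (simp add: space_lam)
  obtain C :: "nat \<Rightarrow> 'g set" where C: "incseq C" "\<And>n. compact (C n)" "(\<Union>n. C n) = UNIV"
    using exhaustion by blast
  have C_sets [measurable]: "C n \<in> sets borel" for n using C(2) by (rule borel_compact)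
  define a where "a n v = (\<integral>\<^sup>+u. ennreal ((cmod (f (u, v)))\<^sup>2) * indicator (- C n) u \<partial>\<nu>)" for n v
  have [measurable]: "a n \<in> borel_measurable lam" for n
    unfolding a_def by measurable
  \<comment> \<open>A v for which no n qualifies gets an unspecified value; the slice at such a v is
    not square integrable, so these v form a null set.\<close>
  define k where "k j v = (LEAST n. a n v \<le> ennreal (1 / 8 ^ j))" for j :: nat and v
  have [measurable]: "k j \<in> lam \<rightarrow>\<^sub>M count_space UNIV" for j
    unfolding k_def by measurable
  define s where "s j v u = f (u, v) * indicator (C (k j v)) u" for j v u
  have s_meas: "case_prod (s j) \<in> borel_measurable (lam \<Otimes>\<^sub>M borel)" for j
  proof -
    have "(\<lambda>p. f (snd p, fst p) * indicator (C (k j (fst p))) (snd p)) \<in> borel_measurable (lam \<Otimes>\<^sub>M borel)"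
      by (rule measurable_compose_countable[where g = "\<lambda>p. k j (fst p)" and
            f = "\<lambda>i p. f (snd p, fst p) * indicator (C i) (snd p)"]) measurable
    then show ?thesis by (simp add: s_def case_prod_beta')
  qed
  define \<Phi> where "\<Phi> p = lim (\<lambda>j. case p of (\<xi>, v) \<Rightarrow> fourier \<nu> (s j v) \<xi>)" for p
  have \<Phi>_meas: "\<Phi> \<in> borel_measurable (\<nu>h \<Otimes>\<^sub>M lam)"
    unfolding \<Phi>_def by (rule borel_measurable_lim_metric) (rule fourier_param_measurable[OF s_meas])
  have "AE v in lam. is_FP \<nu> \<nu>h (\<lambda>u. f (u, v)) (\<lambda>\<xi>. \<Phi> (\<xi>, v))"
    using P.square_integrable_sections(1)[OF f]
  proof eventually_elim
    case (elim v)
    have fin: "(\<integral>\<^sup>+u. ennreal ((cmod (f (u, v)))\<^sup>2) \<partial>\<nu>) < \<infinity>"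
      using elim by (subst (asm) square_integrable_iff_nn_integral) auto
    have "(\<lambda>n. a n v) \<longlonglongrightarrow> (\<integral>\<^sup>+u. 0 \<partial>\<nu>)"
      unfolding a_def
    proof (rule nn_integral_dominated_convergence[where w = "\<lambda>u. ennreal ((cmod (f (u, v)))\<^sup>2)"])
      show "AE u in \<nu>. (\<lambda>n. ennreal ((cmod (f (u, v)))\<^sup>2) * indicator (- C n) u) \<longlonglongrightarrow> 0"
      proof (rule AE_I2)
        fix u
        obtain n where n: "u \<in> C n" using C(3) by auto
        have "\<forall>\<^sub>F m in sequentially. ennreal ((cmod (f (u, v)))\<^sup>2) * indicator (- C m) u = 0"
          using eventually_ge_at_top[of n]
          by eventually_elim (use n C(1) in \<open>auto simp: incseq_def indicator_def\<close>)
        then show "(\<lambda>n. ennreal ((cmod (f (u, v)))\<^sup>2) * indicator (- C n) u) \<longlonglongrightarrow> 0"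
          by (rule tendsto_eventually)
      qed
    qed (use fin in \<open>auto simp: indicator_def\<close>)
    then have lim_a: "(\<lambda>n. a n v) \<longlonglongrightarrow> 0" by simp
    have "\<exists>n. a n v \<le> ennreal (1 / 8 ^ j)" for j :: nat
    proof -
      have "\<forall>\<^sub>F n in sequentially. a n v < ennreal (1 / 8 ^ j)"
        by (rule order_tendstoD(2)[OF lim_a]) simp
      then show ?thesis by (meson eventually_happens' less_imp_le sequentially_bot)
    qed
    then have a_k: "a (k j v) v \<le> ennreal (1 / 8 ^ j)" for j
      unfolding k_def by (rule LeastI_ex)
    have k_mono: "k j v \<le> k i v" if "j \<le> i" for i j
    proof -
      have "1 / 8 ^ i \<le> 1 / (8 ^ j :: real)"
        using that by (intro divide_left_mono power_increasing) auto
      then have "a (k i v) v \<le> ennreal (1 / 8 ^ j)"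
        using a_k[of i] by (meson ennreal_leI order_trans)
      then show ?thesis unfolding k_def[of j] by (rule Least_le)
    qed
    have s_sq: "square_integrable \<nu> (s j v)" for j
    proof (rule square_integrable_bound[OF elim, where C = 1])
      show "s j v \<in> borel_measurable \<nu>" unfolding s_def by measurable
    qed (auto simp: s_def indicator_def)
    have s_int: "integrable \<nu> (s j v)" for j
    proof -
      have "integrable \<nu> (\<lambda>u. f (u, v) * cnj (indicator (C (k j v)) u))"
        by (rule square_integrable_mult_integrable[OF elim indicator_integrable(2)])
           (use C emeasure_compact in auto)
      moreover have "(\<lambda>u. f (u, v) * cnj (indicator (C (k j v)) u)) = s j v"
        by (auto simp: s_def indicator_def fun_eq_iff)
      ultimately show ?thesis by simp
    qed
    \<comment> \<open>Both s_i - s_j for j <= i and s_j - f(., v) vanish on \<open>C (k j v)\<close>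
      and are dominated by |f|, so one bound serves the Cauchy estimate and the convergence to the
      slice.\<close>
    have tail: "(\<integral>u. (cmod (g u))\<^sup>2 \<partial>\<nu>) \<le> 1 / 8 ^ j"
      if "square_integrable \<nu> g" "\<And>u. cmod (g u) \<le> cmod (f (u, v)) * indicator (- C (k j v)) u" for g j
    proof -
      have "ennreal (\<integral>u. (cmod (g u))\<^sup>2 \<partial>\<nu>) = (\<integral>\<^sup>+u. ennreal ((cmod (g u))\<^sup>2) \<partial>\<nu>)"
        by (rule nn_integral_square[OF that(1), symmetric])
      also have "\<dots> \<le> a (k j v) v"
        unfolding a_def
      proof (rule nn_integral_mono)
        fix u
        have "(cmod (g u))\<^sup>2 \<le> (cmod (f (u, v)) * indicator (- C (k j v)) u)\<^sup>2"
          using that(2)[of u] by (rule power_mono) simp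
        then show "ennreal ((cmod (g u))\<^sup>2) \<le> ennreal ((cmod (f (u, v)))\<^sup>2) * indicator (- C (k j v)) u"
          by (auto simp: indicator_def ennreal_leI)
      qed
      also have "\<dots> \<le> ennreal (1 / 8 ^ j)" by (rule a_k)
      finally show ?thesis by (subst (asm) ennreal_le_iff) auto
    qed
    have fast: "L2dist2 \<nu>h (fourier \<nu> (s i v)) (fourier \<nu> (s j v)) \<le> 1 / 8 ^ j" if "j \<le> i" for i j
    proof -
      have "L2dist2 \<nu>h (fourier \<nu> (s i v)) (fourier \<nu> (s j v))
          = (\<integral>\<xi>. (cmod (fourier \<nu> (\<lambda>u. s i v u + (-1) * s j v u) \<xi>))\<^sup>2 \<partial>\<nu>h)"
        unfolding L2dist2_def
        by (intro Bochner_Integration.integral_cong)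
           (auto simp only: fourier_lincomb[OF s_int s_int] space_dual, simp)
      also have "\<dots> = (\<integral>u. (cmod (s i v u + (-1) * s j v u))\<^sup>2 \<partial>\<nu>)"
        by (intro plancherel(2) square_integrable_add square_integrable_cmult s_sq
              Bochner_Integration.integrable_add integrable_mult_right s_int)
      also have "\<dots> \<le> 1 / 8 ^ j"
      proof (rule tail)
        show "square_integrable \<nu> (\<lambda>u. s i v u + (-1) * s j v u)"
          by (intro square_integrable_add square_integrable_cmult s_sq)
        have "C (k j v) \<subseteq> C (k i v)" using k_mono[OF that] C(1) by (simp add: incseq_def)
        then show "cmod (s i v u + (-1) * s j v u) \<le> cmod (f (u, v)) * indicator (- C (k j v)) u" for u
          by (auto simp: s_def indicator_def)
      qed
      finally show ?thesis .
    qed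
    have lim8: "(\<lambda>j. 1 / 8 ^ j :: real) \<longlonglongrightarrow> 0"
      using LIMSEQ_power_zero[of "1 / 8 :: real"] by (simp add: power_divide)
    show ?case
      unfolding is_FP_def
    proof (intro conjI exI[of _ "\<lambda>j. s j v"] allI s_int s_sq)
      show "square_integrable \<nu>h (\<lambda>\<xi>. \<Phi> (\<xi>, v))"
        using L2_fast_Cauchy_limit(1)[OF plancherel(1)[OF s_int s_sq], where C = 1] fast by (simp add: \<Phi>_def)
      show "(\<lambda>j. L2dist2 \<nu>h (fourier \<nu> (s j v)) (\<lambda>\<xi>. \<Phi> (\<xi>, v))) \<longlonglongrightarrow> 0"
        using L2_fast_Cauchy_limit(2)[OF plancherel(1)[OF s_int s_sq], where C = 1] fast by (simp add: \<Phi>_def)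
      have "L2dist2 \<nu> (s j v) (\<lambda>u. f (u, v)) \<le> 1 / 8 ^ j" for j
        unfolding L2dist2_def
        by (rule tail) (auto simp: s_def indicator_def intro: square_integrable_diff[OF s_sq elim, unfolded s_def indicator_def])
      then show "(\<lambda>j. L2dist2 \<nu> (s j v) (\<lambda>u. f (u, v))) \<longlonglongrightarrow> 0"
        by (intro tendsto_sandwich[OF _ _ tendsto_const lim8] always_eventually allI L2dist2_nonneg)
    qed
  qed
  then show ?thesis using \<Phi>_meas unfolding is_FI_def by blast
qed

lemma is_FI_FI: "square_integrable (\<nu> \<Otimes>\<^sub>M lam) f \<Longrightarrow> is_FI \<nu> \<nu>h lam f (FI \<nu> \<nu>h lam f)"
  unfolding FI_def by (rule someI_ex[OF is_FI_exists])

lemma is_FI_measurable [measurable_dest]: "is_FI \<nu> \<nu>h lam f \<Phi> \<Longrightarrow> \<Phi> \<in> borel_measurable (\<nu>h \<Otimes>\<^sub>M lam)"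
  unfolding is_FI_def by simp

lemma is_FI_norm:
  assumes FI: "is_FI \<nu> \<nu>h lam f \<Phi>" and f: "square_integrable (\<nu> \<Otimes>\<^sub>M lam) f"
  shows "square_integrable (\<nu>h \<Otimes>\<^sub>M lam) \<Phi>"
    and "(\<integral>p. (cmod (\<Phi> p))\<^sup>2 \<partial>(\<nu>h \<Otimes>\<^sub>M lam)) \<le> (\<integral>p. (cmod (f p))\<^sup>2 \<partial>(\<nu> \<Otimes>\<^sub>M lam))"
proof -
  note [measurable] = is_FI_measurable[OF FI] square_integrable_measurable[OF f]
  have "(\<integral>\<^sup>+p. ennreal ((cmod (\<Phi> p))\<^sup>2) \<partial>(\<nu>h \<Otimes>\<^sub>M lam)) = (\<integral>\<^sup>+v. \<integral>\<^sup>+\<xi>. ennreal ((cmod (\<Phi> (\<xi>, v)))\<^sup>2) \<partial>\<nu>h \<partial>lam)"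
    by (rule Q.nn_integral_snd[symmetric]) measurable
  also have "\<dots> \<le> (\<integral>\<^sup>+v. \<integral>\<^sup>+u. ennreal ((cmod (f (u, v)))\<^sup>2) \<partial>\<nu> \<partial>lam)"
  proof (rule nn_integral_mono_AE)
    have "AE v in lam. is_FP \<nu> \<nu>h (\<lambda>u. f (u, v)) (\<lambda>\<xi>. \<Phi> (\<xi>, v))"
      using FI unfolding is_FI_def by simp
    then show "AE v in lam. (\<integral>\<^sup>+\<xi>. ennreal ((cmod (\<Phi> (\<xi>, v)))\<^sup>2) \<partial>\<nu>h) \<le> (\<integral>\<^sup>+u. ennreal ((cmod (f (u, v)))\<^sup>2) \<partial>\<nu>)"
      using P.square_integrable_sections(1)[OF f]
    proof eventually_elim
      case (elim v)
      have "square_integrable \<nu>h (\<lambda>\<xi>. \<Phi> (\<xi>, v))" using elim(1) unfolding is_FP_def by simp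
      then show ?case
        using is_FP_norm_le[OF elim] elim(2) by (simp add: nn_integral_square ennreal_leI)
    qed
  qed
  also have "\<dots> = (\<integral>\<^sup>+p. ennreal ((cmod (f p))\<^sup>2) \<partial>(\<nu> \<Otimes>\<^sub>M lam))"
    by (rule P.nn_integral_snd) measurable
  also have "\<dots> = ennreal (\<integral>p. (cmod (f p))\<^sup>2 \<partial>(\<nu> \<Otimes>\<^sub>M lam))"
    by (rule nn_integral_square[OF f])
  finally have le: "(\<integral>\<^sup>+p. ennreal ((cmod (\<Phi> p))\<^sup>2) \<partial>(\<nu>h \<Otimes>\<^sub>M lam)) \<le> ennreal (\<integral>p. (cmod (f p))\<^sup>2 \<partial>(\<nu> \<Otimes>\<^sub>M lam))" .
  then show sq: "square_integrable (\<nu>h \<Otimes>\<^sub>M lam) \<Phi>"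
    by (subst square_integrable_iff_nn_integral) (auto intro: le_less_trans)
  show "(\<integral>p. (cmod (\<Phi> p))\<^sup>2 \<partial>(\<nu>h \<Otimes>\<^sub>M lam)) \<le> (\<integral>p. (cmod (f p))\<^sup>2 \<partial>(\<nu> \<Otimes>\<^sub>M lam))"
    using le unfolding nn_integral_square[OF sq] by (subst (asm) ennreal_le_iff) auto
qed

lemma is_FI_lincomb:
  assumes "is_FI \<nu> \<nu>h lam f \<Phi>" "is_FI \<nu> \<nu>h lam g \<Psi>"
    and "square_integrable (\<nu> \<Otimes>\<^sub>M lam) f" "square_integrable (\<nu> \<Otimes>\<^sub>M lam) g"
  shows "is_FI \<nu> \<nu>h lam (\<lambda>p. f p + c * g p) (\<lambda>p. \<Phi> p + c * \<Psi> p)"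
  unfolding is_FI_def
proof
  note [measurable] = assms(1,2)[THEN is_FI_measurable]
  show "(\<lambda>p. \<Phi> p + c * \<Psi> p) \<in> borel_measurable (\<nu>h \<Otimes>\<^sub>M lam)" by measurable
  have "AE v in lam. is_FP \<nu> \<nu>h (\<lambda>u. f (u, v)) (\<lambda>\<xi>. \<Phi> (\<xi>, v))"
    "AE v in lam. is_FP \<nu> \<nu>h (\<lambda>u. g (u, v)) (\<lambda>\<xi>. \<Psi> (\<xi>, v))"
    using assms(1,2) unfolding is_FI_def by auto
  then show "AE v in lam. is_FP \<nu> \<nu>h (\<lambda>u. f (u, v) + c * g (u, v)) (\<lambda>\<xi>. \<Phi> (\<xi>, v) + c * \<Psi> (\<xi>, v))"
    using P.square_integrable_sections(1)[OF assms(3)] P.square_integrable_sections(1)[OF assms(4)]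
    by eventually_elim (rule is_FP_lincomb)
qed

text \<open>Uniqueness is available slice by slice in v. The quantifiers are exchanged because
  \<open>Rop\<close> integrates over v for fixed \<xi>.\<close>

lemma is_FI_unique:
  assumes "is_FI \<nu> \<nu>h lam f \<Phi>" "is_FI \<nu> \<nu>h lam f \<Psi>" "square_integrable (\<nu> \<Otimes>\<^sub>M lam) f"
  shows "AE \<xi> in \<nu>h. AE v in lam. \<Phi> (\<xi>, v) = \<Psi> (\<xi>, v)"
proof -
  note [measurable] = assms(1,2)[THEN is_FI_measurable]
  have "AE v in lam. is_FP \<nu> \<nu>h (\<lambda>u. f (u, v)) (\<lambda>\<xi>. \<Phi> (\<xi>, v))"
    "AE v in lam. is_FP \<nu> \<nu>h (\<lambda>u. f (u, v)) (\<lambda>\<xi>. \<Psi> (\<xi>, v))"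
    using assms(1,2) unfolding is_FI_def by auto
  then have "AE v in lam. AE \<xi> in \<nu>h. \<Phi> (\<xi>, v) = \<Psi> (\<xi>, v)"
    using P.square_integrable_sections(1)[OF assms(3)]
    by eventually_elim (rule is_FP_unique)
  then show ?thesis
    by (subst Q.AE_commute) simp_all
qed

end

section \<open>The operator \<open>R\<close>\<close>

lemma (in plancherel_pair) is_FP_cong:
  assumes "is_FP \<nu> \<nu>h h g" "\<And>\<xi>. \<xi> \<in> dual_chars \<Longrightarrow> g \<xi> = g' \<xi>"
  shows "is_FP \<nu> \<nu>h h g'"
proof -
  have "square_integrable \<nu>h g' = square_integrable \<nu>h g"
    unfolding square_integrable_def using assms(2)
    by (intro arg_cong2[where f = "(\<and>)"] measurable_cong Bochner_Integration.integrable_cong refl)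
       (auto simp: space_dual)
  moreover have "L2dist2 \<nu>h k g' = L2dist2 \<nu>h k g" for k
    unfolding L2dist2_def using assms(2)
    by (intro Bochner_Integration.integral_cong) (auto simp: space_dual)
  ultimately show ?thesis using assms(1) unfolding is_FP_def by simp
qed

locale rkhs_setting = plancherel_product \<nu> \<nu>h lam
  for \<nu> :: "'g::{ab_group_add, metric_space} measure" and \<nu>h and lam :: "'y measure" +
  fixes H :: "('g \<times> 'y \<Rightarrow> complex) set"
    and K :: "'g \<Rightarrow> 'y \<Rightarrow> 'g \<times> 'y \<Rightarrow> complex"
    and q :: "('g \<Rightarrow> complex) \<Rightarrow> 'y \<Rightarrow> complex"
  assumes rkhs: "rkhs_L2 \<nu> lam H K"
    and transl: "\<And>x y u v. K x y (u, v) = K 0 y (u - x, v)"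
    and Kbound: "\<And>y. \<exists>C::real. \<forall>v. (\<integral>\<^sup>+ u. ennreal (cmod (K 0 y (u, v))) \<partial>\<nu>) \<le> ennreal C"
    and q_meas: "(\<lambda>(\<xi>, v). q \<xi> v) \<in> borel_measurable (restrict_space \<nu>h (Omega \<nu> K) \<Otimes>\<^sub>M lam)"
    and q_fact: "\<And>\<xi> y v. \<xi> \<in> Omega \<nu> K \<Longrightarrow> Lker \<nu> K \<xi> y v = cnj (q \<xi> y) * q \<xi> v"
    and R_isometric: "\<And>g. g \<in> H \<Longrightarrow>
          square_integrable (restrict_space \<nu>h (Omega \<nu> K)) (Rop \<nu> \<nu>h lam q g) \<and>
          (\<integral>\<xi>. (cmod (Rop \<nu> \<nu>h lam q g \<xi>))\<^sup>2 \<partial>(restrict_space \<nu>h (Omega \<nu> K)))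
            = (\<integral>p. (cmod (g p))\<^sup>2 \<partial>(\<nu> \<Otimes>\<^sub>M lam))"
    and R_onto: "\<And>r. square_integrable (restrict_space \<nu>h (Omega \<nu> K)) r \<Longrightarrow>
          \<exists>g\<in>H. AE \<xi> in restrict_space \<nu>h (Omega \<nu> K). Rop \<nu> \<nu>h lam q g \<xi> = r \<xi>"
begin

abbreviation "\<Omega> \<equiv> Omega \<nu> K"
abbreviation "N \<equiv> restrict_space \<nu>h \<Omega>"
abbreviation "R \<equiv> Rop \<nu> \<nu>h lam q"

lemma H_square_integrable: "f \<in> H \<Longrightarrow> square_integrable (\<nu> \<Otimes>\<^sub>M lam) f"
  using rkhs unfolding rkhs_L2_def by blast

lemma H_lincomb: "f \<in> H \<Longrightarrow> g \<in> H \<Longrightarrow> (\<lambda>p. f p + c * g p) \<in> H"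
proof -
  assume "f \<in> H" "g \<in> H"
  moreover have "\<forall>f\<in>H. \<forall>g\<in>H. (\<lambda>p. f p + g p) \<in> H" "\<forall>c. \<forall>f\<in>H. (\<lambda>p. c * f p) \<in> H"
    using rkhs unfolding rkhs_L2_def by blast+
  ultimately show ?thesis by simp
qed

lemma K_in_H: "K x y \<in> H"
  using rkhs unfolding rkhs_L2_def by blast

lemma reproducing: "f \<in> H \<Longrightarrow> f (x, y) = (\<integral>p. f p * cnj (K x y p) \<partial>(\<nu> \<Otimes>\<^sub>M lam))"
  using rkhs unfolding rkhs_L2_def by blast

lemma K_measurable: "K x y \<in> borel_measurable (borel \<Otimes>\<^sub>M lam)"
  using square_integrable_measurable[OF H_square_integrable[OF K_in_H]]
  by (simp cong: measurable_cong_sets sets_pair_measure_cong add: sets_haar)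

lemma K_section_measurable [measurable]: "(\<lambda>u. K x y (u, v)) \<in> borel_measurable borel"
  by (rule measurable_compose[OF measurable_Pair2' K_measurable]) (simp add: space_lam)

lemma K_integrable: "integrable \<nu> (\<lambda>u. K 0 y (u, v))"
proof -
  obtain C :: real where "(\<integral>\<^sup>+ u. ennreal (cmod (K 0 y (u, v))) \<partial>\<nu>) \<le> ennreal C"
    using Kbound by blast
  then show ?thesis
    unfolding integrable_iff_bounded by (auto intro: le_less_trans)
qed

section \<open>The set \<open>Omega\<close> and the transform of the kernel\<close>

lemma Lker_eq_fourier: "Lker \<nu> K \<xi> y v = fourier \<nu> (\<lambda>u. K 0 y (u, v)) \<xi>"
  by (simp add: Lker_def fourier_def)

text \<open>Translation rewrites the left side as \<open>K u y (0, y)\<close>; the rest is the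
  Hermitian symmetry of a reproducing kernel.\<close>

lemma K_hermitian: "K 0 y (- u, y) = cnj (K 0 y (u, y))"
proof -
  have "K 0 y (- u, y) = K u y (0, y)" using transl[of u y 0 y] by simp
  also have "\<dots> = (\<integral>p. K u y p * cnj (K 0 y p) \<partial>(\<nu> \<Otimes>\<^sub>M lam))"
    by (rule reproducing[OF K_in_H])
  also have "\<dots> = (\<integral>p. cnj (K 0 y p * cnj (K u y p)) \<partial>(\<nu> \<Otimes>\<^sub>M lam))"
    by (simp add: mult.commute)
  also have "\<dots> = cnj (K 0 y (u, y))"
    by (simp only: Bochner_Integration.integral_cnj reproducing[OF K_in_H, of 0 y u y, symmetric])
  finally show ?thesis .
qed

lemma Lker_diag_real:
  assumes "\<xi> \<in> dual_chars" shows "Lker \<nu> K \<xi> y y \<in> \<real>"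
proof -
  have [measurable]: "\<xi> \<in> borel_measurable borel" using assms by (rule char_measurable)
  have "cnj (Lker \<nu> K \<xi> y y) = (\<integral>u. cnj (K 0 y (u, y) * cnj (\<xi> u)) \<partial>\<nu>)"
    unfolding Lker_def by (rule Bochner_Integration.integral_cnj[symmetric])
  also have "\<dots> = (\<integral>u. K 0 y (- u, y) * cnj (\<xi> (- u)) \<partial>\<nu>)"
    by (simp add: K_hermitian char_uminus[OF assms])
  also have "\<dots> = Lker \<nu> K \<xi> y y"
    unfolding Lker_def by (rule integral_uminus) measurable
  finally show ?thesis by (simp add: Reals_cnj_iff)
qed

text \<open>The union over y may be uncountable, so measurability comes from openness.
  \<open>Lker_diag_real\<close> reduces the condition "real and positive" to the open condition that
  the real part is positive.\<close>

lemma Omega_sets: "\<Omega> \<in> sets \<nu>h"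
proof -
  have "\<Omega> = (\<Union>y. {\<xi>\<in>dual_chars. fourier \<nu> (\<lambda>u. K 0 y (u, y)) \<xi> \<in> {z. Re z > 0}})"
    using Lker_diag_real by (auto simp: Omega_def Lker_eq_fourier)
  moreover have "openin dual_topology \<dots>"
    using openin_fourier[OF K_integrable open_halfspace_Re_gt[of 0]] by (intro openin_Union) auto
  ultimately show ?thesis using openin_sets_dual by simp
qed

lemma Omega_Int_sets [simp]: "\<Omega> \<inter> space \<nu>h \<in> sets \<nu>h"
  using Omega_sets by auto

lemma space_N: "space N = \<Omega>"
  using sets.sets_into_space[OF Omega_sets] by (auto simp: space_restrict_space)

lemma Omega_subset: "\<xi> \<in> \<Omega> \<Longrightarrow> \<xi> \<in> dual_chars"
  by (simp add: Omega_def)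

sublocale N: sigma_finite_measure N
  by (rule sigma_finite_measure_restrict_space[OF dual.sigma_finite_measure_axioms Omega_sets])

sublocale NL: pair_sigma_finite N lam ..

lemma AE_N: "AE \<xi> in \<nu>h. P \<xi> \<Longrightarrow> AE \<xi> in N. P \<xi>"
  by (subst AE_restrict_space_iff) auto

lemma AE_N_I: "(\<And>\<xi>. \<xi> \<in> \<Omega> \<Longrightarrow> P \<xi>) \<Longrightarrow> AE \<xi> in N. P \<xi>"
  by (rule AE_I2) (simp add: space_N)

lemma AE_N_Omega: "AE \<xi> in N. \<xi> \<in> \<Omega>"
  by (rule AE_N_I)

lemma q_pair_measurable [measurable]: "(\<lambda>p. q (fst p) (snd p)) \<in> borel_measurable (N \<Otimes>\<^sub>M lam)"
  using q_meas by (simp add: case_prod_beta')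

lemma q_section_measurable [measurable]: "\<xi> \<in> \<Omega> \<Longrightarrow> q \<xi> \<in> borel_measurable lam"
  using measurable_compose[OF measurable_Pair1' q_pair_measurable, of \<xi>] by (simp add: space_N)

lemma q_eval_measurable [measurable]: "(\<lambda>\<xi>. q \<xi> y) \<in> borel_measurable N"
  using measurable_compose[OF measurable_Pair2' q_pair_measurable, of y] by (simp add: space_lam)

lemma eval_N_measurable [measurable]: "(\<lambda>\<xi>. \<xi> x) \<in> borel_measurable N"
  by (rule measurable_restrict_space1[OF eval_measurable])

lemma Lker_pair_measurable: "(\<lambda>(\<xi>, v). Lker \<nu> K \<xi> y v) \<in> borel_measurable (\<nu>h \<Otimes>\<^sub>M lam)"
proof -
  have "(\<lambda>(v, u). K 0 y (u, v)) \<in> borel_measurable (lam \<Otimes>\<^sub>M borel)"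
    using measurable_compose[OF measurable_pair_swap' K_measurable[of 0 y]]
    by (simp add: case_prod_beta')
  from fourier_param_measurable[OF this] show ?thesis by (simp add: Lker_eq_fourier)
qed

text \<open>The slices of the kernel are integrable, so their transforms are given by the Fourier
  integral itself, and the translation by x becomes the factor \<open>cnj (\<xi> x)\<close>.\<close>

lemma is_FI_K: "is_FI \<nu> \<nu>h lam (K x y) (\<lambda>(\<xi>, v). cnj (\<xi> x) * Lker \<nu> K \<xi> y v)"
  unfolding is_FI_def
proof
  have "(\<lambda>p. cnj (fst p x) * (case p of (\<xi>, v) \<Rightarrow> Lker \<nu> K \<xi> y v)) \<in> borel_measurable (\<nu>h \<Otimes>\<^sub>M lam)"
    by (intro borel_measurable_times borel_measurable_cnj Lker_pair_measurable
        measurable_compose[OF measurable_fst eval_measurable])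
  then show "(\<lambda>(\<xi>, v). cnj (\<xi> x) * Lker \<nu> K \<xi> y v) \<in> borel_measurable (\<nu>h \<Otimes>\<^sub>M lam)"
    by (simp add: case_prod_beta')
  show "AE v in lam. is_FP \<nu> \<nu>h (\<lambda>u. K x y (u, v)) (\<lambda>\<xi>. case (\<xi>, v) of (\<xi>, v) \<Rightarrow> cnj (\<xi> x) * Lker \<nu> K \<xi> y v)"
    using P.square_integrable_sections(1)[OF H_square_integrable[OF K_in_H[of x y]]]
  proof eventually_elim
    case (elim v)
    have "integrable \<nu> (\<lambda>u. K 0 y (u + - x, v))" by (rule integrable_translate[OF K_integrable])
    then have "integrable \<nu> (\<lambda>u. K x y (u, v))" by (subst transl) simp
    then have "is_FP \<nu> \<nu>h (\<lambda>u. K x y (u, v)) (fourier \<nu> (\<lambda>u. K x y (u, v)))"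
      using elim by (rule is_FP_fourier)
    then show ?case
    proof (rule is_FP_cong)
      fix \<xi> :: "'g \<Rightarrow> complex" assume \<xi>: "\<xi> \<in> dual_chars"
      have [measurable]: "\<xi> \<in> borel_measurable borel" using \<xi> by (rule char_measurable)
      have "fourier \<nu> (\<lambda>u. K x y (u, v)) \<xi> = (\<integral>u. (\<lambda>t. K 0 y (t, v) * cnj (\<xi> (t + x))) (u + - x) \<partial>\<nu>)"
        unfolding fourier_def by (subst transl) simp
      also have "\<dots> = (\<integral>t. K 0 y (t, v) * cnj (\<xi> (t + x)) \<partial>\<nu>)"
        by (rule integral_translate) measurable
      also have "\<dots> = (\<integral>t. cnj (\<xi> x) * (K 0 y (t, v) * cnj (\<xi> t)) \<partial>\<nu>)"
        by (simp add: char_add[OF \<xi>] mult_ac)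
      also have "\<dots> = cnj (\<xi> x) * Lker \<nu> K \<xi> y v" by (simp add: Lker_def)
      finally show "fourier \<nu> (\<lambda>u. K x y (u, v)) \<xi> = (case (\<xi>, v) of (\<xi>, v) \<Rightarrow> cnj (\<xi> x) * Lker \<nu> K \<xi> y v)"
        by simp
    qed
  qed
qed

text \<open>Where q_\<xi>(y) is nonzero, q_\<xi> is a multiple of the transform of
  \<open>K 0 y\<close> at \<xi>, which is square integrable for almost all \<xi>. After exchanging
  null sets, a q_\<xi> of infinite norm would have to vanish for almost all y, which is
  absurd.\<close>

lemma q_square_integrable: "AE \<xi> in N. square_integrable lam (q \<xi>)"
proof -
  define n where "n \<xi> = (\<integral>\<^sup>+v. ennreal ((cmod (q \<xi> v))\<^sup>2) \<partial>lam)" for \<xi>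
  have [measurable]: "n \<in> borel_measurable N" unfolding n_def by measurable
  have sq: "square_integrable lam (q \<xi>) \<longleftrightarrow> n \<xi> < \<infinity>" if "\<xi> \<in> \<Omega>" for \<xi>
    unfolding n_def using that by (intro square_integrable_iff_nn_integral) simp
  have "AE \<xi> in N. q \<xi> y = 0 \<or> n \<xi> < \<infinity>" for y
  proof -
    have "square_integrable (\<nu>h \<Otimes>\<^sub>M lam) (\<lambda>(\<xi>, v). cnj (\<xi> 0) * Lker \<nu> K \<xi> y v)"
      by (rule is_FI_norm(1)[OF is_FI_K H_square_integrable[OF K_in_H]])
    from AE_N[OF Q.square_integrable_sections(2)[OF this]] AE_N_Omega show ?thesis
    proof eventually_elim
      case (elim \<xi>)
      then have *: "square_integrable lam (\<lambda>v. cnj (q \<xi> y) * q \<xi> v)"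
        by (simp add: char_zero Omega_subset q_fact)
      show ?case
      proof (cases "q \<xi> y = 0")
        case False
        have "square_integrable lam (q \<xi>)"
          using square_integrable_cmult[OF *, of "1 / cnj (q \<xi> y)"] False by simp
        then show ?thesis using sq elim by simp
      qed simp
    qed
  qed
  then have "AE y in lam. AE \<xi> in N. q \<xi> y = 0 \<or> n \<xi> < \<infinity>" by simp
  then have "AE \<xi> in N. AE y in lam. q \<xi> y = 0 \<or> n \<xi> < \<infinity>"
    by (subst NL.AE_commute) simp_all
  then show ?thesis using AE_N_Omega
  proof eventually_elim
    case (elim \<xi>)
    show ?case
    proof (rule ccontr)
      assume "\<not> square_integrable lam (q \<xi>)"
      then have inf: "\<not> n \<xi> < \<infinity>" using sq elim by simp
      then have "AE y in lam. ennreal ((cmod (q \<xi> y))\<^sup>2) = 0" using elim(1) by simp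
      then have "n \<xi> = 0" unfolding n_def using elim(2) by (subst nn_integral_0_iff_AE) auto
      then show False using inf by simp
    qed
  qed
qed

lemma is_FI_section_measurable:
  assumes "is_FI \<nu> \<nu>h lam f \<Phi>" "\<xi> \<in> \<Omega>"
  shows "(\<lambda>v. \<Phi> (\<xi>, v)) \<in> borel_measurable lam"
  using measurable_compose[OF measurable_Pair1' is_FI_measurable[OF assms(1)], of \<xi>]
    assms(2) Omega_subset by (simp add: space_dual)

text \<open>Frees \<open>R\<close> from the representative chosen by \<open>FI\<close>, so that it
  can be computed from explicit or linearly combined transforms.\<close>

lemma R_eq:
  assumes \<Phi>: "is_FI \<nu> \<nu>h lam f \<Phi>" and f: "f \<in> H"
  shows "AE \<xi> in N. R f \<xi> = (\<integral>v. \<Phi> (\<xi>, v) * cnj (q \<xi> v) \<partial>lam)"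
proof -
  have FI: "is_FI \<nu> \<nu>h lam f (FI \<nu> \<nu>h lam f)" by (rule is_FI_FI[OF H_square_integrable[OF f]])
  show ?thesis
    using AE_N[OF is_FI_unique[OF FI \<Phi> H_square_integrable[OF f]]] AE_N_Omega
  proof eventually_elim
    case (elim \<xi>)
    note [measurable] = is_FI_section_measurable[OF FI elim(2)] is_FI_section_measurable[OF \<Phi> elim(2)]
      q_section_measurable[OF elim(2)]
    show ?case
      unfolding Rop_def
      by (rule integral_cong_AE) (use elim(1) in \<open>measurable, auto\<close>)
  qed
qed

lemma R_lincomb:
  assumes f: "f \<in> H" and g: "g \<in> H"
  shows "AE \<xi> in N. R (\<lambda>p. f p + c * g p) \<xi> = R f \<xi> + c * R g \<xi>"
proof -
  note sq = H_square_integrable[OF f] H_square_integrable[OF g]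
  note FI = is_FI_FI[OF sq(1)] is_FI_FI[OF sq(2)]
  show ?thesis
    using R_eq[OF is_FI_lincomb[OF FI sq, of c] H_lincomb[OF f g]] q_square_integrable
      AE_N[OF Q.square_integrable_sections(2)[OF is_FI_norm(1)[OF FI(1) sq(1)]]]
      AE_N[OF Q.square_integrable_sections(2)[OF is_FI_norm(1)[OF FI(2) sq(2)]]]
  proof eventually_elim
    case (elim \<xi>)
    show ?case
      unfolding elim(1) unfolding Rop_def
      using square_integrable_mult_integrable[OF elim(3,2)] square_integrable_mult_integrable[OF elim(4,2)]
      by (simp add: distrib_right mult.assoc)
  qed
qed

lemma R_square_integrable: "f \<in> H \<Longrightarrow> square_integrable N (R f)"
  using R_isometric by blast

lemma R_inner:
  assumes f: "f \<in> H" and g: "g \<in> H"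
  shows "(\<integral>\<xi>. R f \<xi> * cnj (R g \<xi>) \<partial>N) = (\<integral>p. f p * cnj (g p) \<partial>(\<nu> \<Otimes>\<^sub>M lam))"
proof (rule inner_eq_if_norm_eq)
  fix c
  have fg: "(\<lambda>p. f p + c * g p) \<in> H" by (rule H_lincomb[OF f g])
  note [measurable] = R_square_integrable[OF f, THEN square_integrable_measurable]
    R_square_integrable[OF g, THEN square_integrable_measurable]
    R_square_integrable[OF fg, THEN square_integrable_measurable]
  have "(\<integral>\<xi>. (cmod (R f \<xi> + c * R g \<xi>))\<^sup>2 \<partial>N) = (\<integral>\<xi>. (cmod (R (\<lambda>p. f p + c * g p) \<xi>))\<^sup>2 \<partial>N)"
    by (rule integral_cong_AE) (use R_lincomb[OF f g, of c] in \<open>measurable, auto\<close>)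
  also have "\<dots> = (\<integral>p. (cmod (f p + c * g p))\<^sup>2 \<partial>(\<nu> \<Otimes>\<^sub>M lam))"
    using R_isometric[OF fg] by blast
  finally show "(\<integral>\<xi>. (cmod (R f \<xi> + c * R g \<xi>))\<^sup>2 \<partial>N) = (\<integral>p. (cmod (f p + c * g p))\<^sup>2 \<partial>(\<nu> \<Otimes>\<^sub>M lam))" .
qed (use assms R_square_integrable H_square_integrable in auto)

definition qnorm2 :: "('g \<Rightarrow> complex) \<Rightarrow> real" where
  "qnorm2 \<xi> = (\<integral>v. (cmod (q \<xi> v))\<^sup>2 \<partial>lam)"

lemma qnorm2_measurable [measurable]: "qnorm2 \<in> borel_measurable N"
  unfolding qnorm2_def by measurable

lemma qnorm2_nonneg: "qnorm2 \<xi> \<ge> 0"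
  unfolding qnorm2_def by simp

lemma R_K_qnorm2: "AE \<xi> in N. R (K x y) \<xi> = cnj (\<xi> x) * cnj (q \<xi> y) * complex_of_real (qnorm2 \<xi>)"
  using R_eq[OF is_FI_K K_in_H, of x y] AE_N_Omega
proof eventually_elim
  case (elim \<xi>)
  have "R (K x y) \<xi> = (\<integral>v. cnj (\<xi> x) * cnj (q \<xi> y) * complex_of_real ((cmod (q \<xi> v))\<^sup>2) \<partial>lam)"
    unfolding elim(1) by (simp only: prod.case q_fact[OF elim(2)] complex_norm_square mult.assoc)
  then show ?case by (simp only: integral_mult_right_zero qnorm2_def integral_complex_of_real)
qed

end

section \<open>The functions \<open>q\<^sub>\<xi>\<close> are unit vectors\<close>

context rkhs_setting
begin

text \<open>If \<open>\<parallel>q\<^sub>\<xi>\<parallel> < 1\<close> on a set \<open>A\<close> of positive finite measure, then a preimage under \<open>R\<close> of the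
  indicator of \<open>A\<close> would have a norm exceeding that of its image, by Cauchy--Schwarz in \<open>v\<close>.\<close>

lemma qnorm2_ge_1: "AE \<xi> in N. 1 \<le> qnorm2 \<xi>"
proof -
  obtain E :: "nat \<Rightarrow> ('g \<Rightarrow> complex) set" where E: "range E \<subseteq> sets N" "(\<Union>i. E i) = space N"
    "\<And>i. emeasure N (E i) \<noteq> \<infinity>"
    using N.sigma_finite by metis
  have "AE \<xi> in N. \<not> (\<xi> \<in> E i \<and> qnorm2 \<xi> < 1)" for i
  proof -
    have [measurable]: "E i \<in> sets N" using E(1) by auto
    \<comment> \<open>The finite-measure set \<open>E i\<close> makes the indicator of
      \<open>A\<close> square integrable, so that it has a preimage under \<open>R\<close>.\<close>
    define A where "A = {\<xi>\<in>space N. \<xi> \<in> E i \<and> qnorm2 \<xi> < 1}"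
    have A_sets [measurable]: "A \<in> sets N" unfolding A_def by measurable
    have "emeasure N A \<le> emeasure N (E i)" by (rule emeasure_mono) (auto simp: A_def)
    then have A_fin: "emeasure N A < \<infinity>" using E(3)[of i] by (simp add: less_top order_le_less_trans)
    have A_int: "integrable N (indicator A :: _ \<Rightarrow> real)"
      using A_fin by (intro integrable_real_indicator) auto
    have sq_eq: "(\<lambda>\<xi>. (cmod (indicator A \<xi>))\<^sup>2) = (indicator A :: _ \<Rightarrow> real)"
      by (auto simp: indicator_def)
    have "square_integrable N (indicator A)"
      unfolding square_integrable_def sq_eq using A_int by simp
    then obtain g where g: "g \<in> H" and Rg: "AE \<xi> in N. R g \<xi> = indicator A \<xi>"
      using R_onto by blast
    note sq = H_square_integrable[OF g]
    define \<Phi> where "\<Phi> = FI \<nu> \<nu>h lam g"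
    have FI: "is_FI \<nu> \<nu>h lam g \<Phi>" unfolding \<Phi>_def by (rule is_FI_FI[OF sq])
    note \<Phi>_sq = is_FI_norm[OF FI sq]
    define \<Psi> where "\<Psi> \<xi> = (\<integral>v. (cmod (\<Phi> (\<xi>, v)))\<^sup>2 \<partial>lam)" for \<xi>
    have \<Psi>_nonneg: "0 \<le> \<Psi> \<xi>" for \<xi> unfolding \<Psi>_def by simp
    have \<Phi>_int: "integrable (\<nu>h \<Otimes>\<^sub>M lam) (\<lambda>p. (cmod (\<Phi> p))\<^sup>2)"
      by (rule square_integrable_integrable[OF \<Phi>_sq(1)])
    have \<Psi>_int: "integrable \<nu>h \<Psi>" unfolding \<Psi>_def by (rule Q.integrable_fst'[OF \<Phi>_int])
    have \<Psi>_int_N: "integrable N \<Psi>"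
      using integrable_mult_indicator[OF Omega_sets \<Psi>_int]
      by (subst integrable_restrict_space) (rule Omega_Int_sets)
    \<comment> \<open>Restriction to \<open>\<Omega>\<close> and the transform in the first variable
      do not increase the norm, and \<open>R\<close> preserves it; hence the mass of
      \<open>\<Psi>\<close> over \<open>\<Omega>\<close> is at most the measure of
      \<open>A\<close>.\<close>
    have "(\<integral>\<xi>. \<Psi> \<xi> \<partial>N) = (\<integral>\<xi>. indicator \<Omega> \<xi> *\<^sub>R \<Psi> \<xi> \<partial>\<nu>h)"
      by (rule integral_restrict_space) simp
    also have "\<dots> \<le> (\<integral>\<xi>. \<Psi> \<xi> \<partial>\<nu>h)"
      using \<Psi>_int \<Psi>_nonneg Omega_sets
      by (intro integral_mono integrable_mult_indicator) (auto simp: indicator_def)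
    also have "\<dots> = (\<integral>p. (cmod (\<Phi> p))\<^sup>2 \<partial>(\<nu>h \<Otimes>\<^sub>M lam))"
      unfolding \<Psi>_def by (rule Q.integral_fst'[OF \<Phi>_int])
    also have "\<dots> \<le> (\<integral>p. (cmod (g p))\<^sup>2 \<partial>(\<nu> \<Otimes>\<^sub>M lam))" by (rule \<Phi>_sq(2))
    also have "\<dots> = (\<integral>\<xi>. (cmod (R g \<xi>))\<^sup>2 \<partial>N)" using R_isometric[OF g] by simp
    also have "\<dots> = (\<integral>\<xi>. indicator A \<xi> \<partial>N)"
    proof (rule integral_cong_AE)
      note [measurable] = square_integrable_measurable[OF R_square_integrable[OF g]]
      show "(\<lambda>\<xi>. (cmod (R g \<xi>))\<^sup>2) \<in> borel_measurable N" by measurable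
      show "AE \<xi> in N. (cmod (R g \<xi>))\<^sup>2 = indicator A \<xi>"
        using Rg by eventually_elim (simp add: indicator_def)
    qed simp
    finally have le: "(\<integral>\<xi>. \<Psi> \<xi> \<partial>N) \<le> (\<integral>\<xi>. indicator A \<xi> \<partial>N)" .
    \<comment> \<open>This is Cauchy-Schwarz in v applied to the integral defining R g. As
      \<open>qnorm2\<close> is below 1 on \<open>A\<close>, it forces \<open>\<Psi>\<close> to be at
      least the indicator of \<open>A\<close>.\<close>
    have ge1: "AE \<xi> in N. \<xi> \<in> A \<longrightarrow> 1 \<le> \<Psi> \<xi> * qnorm2 \<xi>"
      using Rg q_square_integrable AE_N[OF Q.square_integrable_sections(2)[OF \<Phi>_sq(1)]]
    proof eventually_elim
      case (elim \<xi>)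
      have "(cmod (R g \<xi>))\<^sup>2 \<le> \<Psi> \<xi> * qnorm2 \<xi>"
        using Cauchy_Schwarz_integral[OF elim(3,2)]
        by (simp add: Rop_def \<Phi>_def[symmetric] \<Psi>_def qnorm2_def)
      then show ?case using elim(1) by auto
    qed
    have "AE \<xi> in N. 0 \<le> \<Psi> \<xi> - indicator A \<xi>"
      using ge1
    proof eventually_elim
      case (elim \<xi>)
      show ?case
      proof (cases "\<xi> \<in> A")
        case True
        then have "\<Psi> \<xi> * qnorm2 \<xi> \<le> \<Psi> \<xi> * 1"
          using \<Psi>_nonneg by (intro mult_left_mono) (auto simp: A_def)
        then show ?thesis using elim True by simp
      qed (simp add: \<Psi>_nonneg)
    qed
    moreover have "(\<integral>\<xi>. \<Psi> \<xi> - indicator A \<xi> \<partial>N) = 0"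
    proof (rule antisym)
      show "(\<integral>\<xi>. \<Psi> \<xi> - indicator A \<xi> \<partial>N) \<le> 0" using le \<Psi>_int_N A_int by simp
      show "0 \<le> (\<integral>\<xi>. \<Psi> \<xi> - indicator A \<xi> \<partial>N)" by (rule integral_nonneg_AE) fact
    qed
    \<comment> \<open>On \<open>A\<close> the equality \<Psi> = 1 reduces \<open>ge1\<close> to 1 <=
      \<open>qnorm2\<close>, so almost no point can lie in \<open>A\<close>.\<close>
    ultimately have "AE \<xi> in N. \<Psi> \<xi> - indicator A \<xi> = 0"
      using \<Psi>_int_N A_int by (subst integral_nonneg_eq_0_iff_AE[symmetric]) auto
    then show ?thesis using ge1 AE_space[of N]
    proof eventually_elim
      case (elim \<xi>)
      show ?case
      proof
        assume "\<xi> \<in> E i \<and> qnorm2 \<xi> < 1"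
        then have "\<xi> \<in> A" "qnorm2 \<xi> < 1" using elim by (auto simp: A_def)
        then show False using elim by simp
      qed
    qed
  qed
  then have "AE \<xi> in N. \<forall>i. \<not> (\<xi> \<in> E i \<and> qnorm2 \<xi> < 1)" by (subst AE_all_countable) simp
  then show ?thesis using AE_space[of N]
  proof eventually_elim
    case (elim \<xi>)
    then obtain i where "\<xi> \<in> E i" using E(2) by blast
    then show ?case using elim by (auto simp: not_less)
  qed
qed

text \<open>The function \<open>k(u) = K\<^sub>0\<^sub>,\<^sub>y(u, y)\<close> is the inverse transform of \<open>m = |q\<^sub>\<xi>(y)|\<^sup>2 \<parallel>q\<^sub>\<xi>\<parallel>\<^sup>4\<close>. Tested against
  a nonnegative transform \<open>w = Fh\<close>, Plancherel gives \<open>\<integral> w m = \<integral> w Fk\<close>, and \<open>Fk\<close> is \<open>|q\<^sub>\<xi>(y)|\<^sup>2\<close> on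
  \<open>\<Omega>\<close> and nonpositive off \<open>\<Omega>\<close>.\<close>

lemma qnorm2_eq_1_if_nonzero: "AE \<xi> in N. q \<xi> y = 0 \<or> qnorm2 \<xi> = 1"
proof -
  define m where "m \<xi> = (cmod (q \<xi> y))\<^sup>2 * (qnorm2 \<xi>)\<^sup>2" for \<xi>
  have m_meas [measurable]: "m \<in> borel_measurable N" unfolding m_def by measurable
  have m_nonneg: "m \<xi> \<ge> 0" for \<xi> by (simp add: m_def)
  have m_int: "integrable N m"
  proof (rule Bochner_Integration.integrable_bound)
    show "integrable N (\<lambda>\<xi>. (cmod (R (K 0 y) \<xi>))\<^sup>2)"
      using R_square_integrable[OF K_in_H] by (rule square_integrable_integrable)
    show "AE \<xi> in N. norm (m \<xi>) \<le> norm ((cmod (R (K 0 y) \<xi>))\<^sup>2)"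
      using R_K_qnorm2[of 0 y] AE_N_Omega
      by eventually_elim (simp add: m_def norm_mult char_norm[OF Omega_subset] power_mult_distrib)
  qed simp
  define k where "k u = K 0 y (u, y)" for u
  have k_eq: "k u = (\<integral>\<xi>. \<xi> u * complex_of_real (m \<xi>) \<partial>N)" for u
  proof -
    have "k u = (\<integral>p. K 0 y p * cnj (K u y p) \<partial>(\<nu> \<Otimes>\<^sub>M lam))"
      unfolding k_def by (rule reproducing[OF K_in_H])
    also have "\<dots> = (\<integral>\<xi>. R (K 0 y) \<xi> * cnj (R (K u y) \<xi>) \<partial>N)"
      by (rule R_inner[OF K_in_H K_in_H, symmetric])
    also have "\<dots> = (\<integral>\<xi>. \<xi> u * complex_of_real (m \<xi>) \<partial>N)"
    proof (rule integral_cong_AE)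
      note [measurable] = square_integrable_measurable[OF R_square_integrable[OF K_in_H]]
      show "(\<lambda>\<xi>. R (K 0 y) \<xi> * cnj (R (K u y) \<xi>)) \<in> borel_measurable N" by measurable
      show "(\<lambda>\<xi>. \<xi> u * complex_of_real (m \<xi>)) \<in> borel_measurable N" by measurable
      show "AE \<xi> in N. R (K 0 y) \<xi> * cnj (R (K u y) \<xi>) = \<xi> u * complex_of_real (m \<xi>)"
        using R_K_qnorm2[of 0 y] R_K_qnorm2[of u y] AE_N_Omega
      proof eventually_elim
        case (elim \<xi>)
        have "R (K 0 y) \<xi> * cnj (R (K u y) \<xi>)
            = \<xi> u * ((q \<xi> y * cnj (q \<xi> y)) * (complex_of_real (qnorm2 \<xi>))\<^sup>2)"
          unfolding elim(1,2) using elim(3)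
          by (simp add: char_zero[OF Omega_subset] power2_eq_square)
        then show ?case by (simp only: m_def of_real_mult complex_norm_square[symmetric] of_real_power)
      qed
    qed
    finally show ?thesis .
  qed
  have k_int: "integrable \<nu> k" unfolding k_def by (rule K_integrable)
  \<comment> \<open>A bounded integrable function is square integrable, which makes Plancherel
    applicable to \<open>k\<close>.\<close>
  have k_bound: "cmod (k u) \<le> (\<integral>\<xi>. m \<xi> \<partial>N)" for u
  proof -
    have "cmod (k u) \<le> (\<integral>\<xi>. cmod (\<xi> u * complex_of_real (m \<xi>)) \<partial>N)"
      unfolding k_eq by (rule integral_norm_bound)
    also have "\<dots> = (\<integral>\<xi>. m \<xi> \<partial>N)"
      by (rule Bochner_Integration.integral_cong)
         (auto simp: norm_mult space_N char_norm[OF Omega_subset] m_nonneg)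
    finally show ?thesis .
  qed
  have k_sq: "square_integrable \<nu> k"
    unfolding square_integrable_def
  proof
    show [measurable]: "k \<in> borel_measurable \<nu>" using k_int by auto
    show "integrable \<nu> (\<lambda>u. (cmod (k u))\<^sup>2)"
    proof (rule Bochner_Integration.integrable_bound)
      show "integrable \<nu> (\<lambda>u. (\<integral>\<xi>. m \<xi> \<partial>N) * cmod (k u))" using k_int by simp
      show "AE u in \<nu>. norm ((cmod (k u))\<^sup>2) \<le> norm ((\<integral>\<xi>. m \<xi> \<partial>N) * cmod (k u))"
      proof (rule AE_I2)
        fix u
        have "(cmod (k u))\<^sup>2 \<le> (\<integral>\<xi>. m \<xi> \<partial>N) * cmod (k u)"
          unfolding power2_eq_square by (rule mult_right_mono[OF k_bound norm_ge_zero])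
        then show "norm ((cmod (k u))\<^sup>2) \<le> norm ((\<integral>\<xi>. m \<xi> \<partial>N) * cmod (k u))" by simp
      qed
    qed measurable
  qed
  have Fk: "fourier \<nu> k \<xi> = Lker \<nu> K \<xi> y y" for \<xi>
    unfolding k_def Lker_eq_fourier ..
  have q_int: "integrable N (\<lambda>\<xi>. (cmod (q \<xi> y))\<^sup>2)"
  proof (rule Bochner_Integration.integrable_bound[OF m_int])
    show "AE \<xi> in N. norm ((cmod (q \<xi> y))\<^sup>2) \<le> norm (m \<xi>)"
      using qnorm2_ge_1
    proof eventually_elim
      case (elim \<xi>)
      then have "(cmod (q \<xi> y))\<^sup>2 * 1 \<le> (cmod (q \<xi> y))\<^sup>2 * (qnorm2 \<xi>)\<^sup>2"
        by (intro mult_left_mono one_le_power) auto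
      then show ?case by (simp add: m_def)
    qed
  qed simp
  obtain B :: "nat \<Rightarrow> 'g set" where B: "\<And>j. B j \<in> sets borel" "\<And>j. emeasure \<nu> (B j) < \<infinity>"
    "\<And>\<xi>. \<xi> \<in> dual_chars \<Longrightarrow> \<exists>j. fourier \<nu> (indicator (B j)) \<xi> \<noteq> 0"
    using test_sets by blast
  have "AE \<xi> in N. (cmod (fourier \<nu> (indicator (B j)) \<xi>))\<^sup>2 * (m \<xi> - (cmod (q \<xi> y))\<^sup>2) = 0" for j
  proof -
    define w where "w \<xi> = (cmod (fourier \<nu> (indicator (B j)) \<xi>))\<^sup>2" for \<xi>
    define h where "h u = (\<integral>s. indicator (B j) (u + s) * indicator (B j) s \<partial>\<nu> :: complex)" for u
    have h: "integrable \<nu> h" "square_integrable \<nu> h"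
      "\<And>\<xi>. \<xi> \<in> dual_chars \<Longrightarrow> fourier \<nu> h \<xi> = complex_of_real (w \<xi>)"
      unfolding h_def w_def using autocorrelation[OF B(1)[of j] B(2)[of j]] by auto
    have w_nonneg: "w \<xi> \<ge> 0" for \<xi> by (simp add: w_def)
    have "square_integrable \<nu>h (fourier \<nu> (indicator (B j)))"
      by (intro plancherel indicator_integrable B)
    note [measurable] = square_integrable_measurable[OF this]
    have [measurable]: "w \<in> borel_measurable \<nu>h" unfolding w_def by measurable
    then have [measurable]: "w \<in> borel_measurable N" by (rule measurable_restrict_space1)
    \<comment> \<open>The L1 norm of \<open>h\<close> bounds its transform \<open>w\<close> on
      characters, so multiplication by \<open>w\<close> preserves integrability over
      \<open>\<Omega>\<close>.\<close>
    define c where "c = (\<integral>u. cmod (h u) \<partial>\<nu>)"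
    have w_bound: "w \<xi> \<le> c" if "\<xi> \<in> dual_chars" for \<xi>
    proof -
      have "w \<xi> = cmod (fourier \<nu> h \<xi>)" using h(3)[OF that] w_nonneg by simp
      also have "\<dots> \<le> (\<integral>u. cmod (h u * cnj (\<xi> u)) \<partial>\<nu>)"
        unfolding fourier_def by (rule integral_norm_bound)
      also have "\<dots> = c" by (simp add: c_def norm_mult char_norm[OF that])
      finally show ?thesis .
    qed
    have w_int: "integrable N (\<lambda>\<xi>. w \<xi> * g \<xi>)" if "integrable N g" for g :: "_ \<Rightarrow> real"
    proof (rule Bochner_Integration.integrable_bound)
      show "integrable N (\<lambda>\<xi>. c * g \<xi>)" using that by simp
      note [measurable] = borel_measurable_integrable[OF that]
      show "(\<lambda>\<xi>. w \<xi> * g \<xi>) \<in> borel_measurable N" by measurable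
      show "AE \<xi> in N. norm (w \<xi> * g \<xi>) \<le> norm (c * g \<xi>)"
        using AE_N_Omega
      proof eventually_elim
        case (elim \<xi>)
        have "\<bar>w \<xi>\<bar> \<le> \<bar>c\<bar>" using w_bound[OF Omega_subset[OF elim]] w_nonneg[of \<xi>] by simp
        then show ?case by (simp add: abs_mult mult_right_mono)
      qed
    qed
    interpret GN: pair_sigma_finite \<nu> N ..
    have eval: "(\<lambda>p. snd p (fst p)) \<in> borel_measurable (\<nu> \<Otimes>\<^sub>M N)"
    proof (rule eval_compose_measurable)
      have "(\<lambda>\<xi>. \<xi>) \<in> N \<rightarrow>\<^sub>M \<nu>h"
        by (rule measurable_restrict_space1[OF measurable_ident_sets[OF refl]])
      then show "snd \<in> \<nu> \<Otimes>\<^sub>M N \<rightarrow>\<^sub>M \<nu>h"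
        by (rule measurable_compose[OF measurable_snd])
    qed measurable
    note [measurable] = eval borel_measurable_integrable[OF h(1)]
    let ?G = "\<lambda>u \<xi>. h u * (cnj (\<xi> u) * complex_of_real (m \<xi>))"
    have G_int: "integrable (\<nu> \<Otimes>\<^sub>M N) (\<lambda>(u, \<xi>). ?G u \<xi>)"
    proof (rule GN.Fubini_integrable)
      show "(\<lambda>(u, \<xi>). ?G u \<xi>) \<in> borel_measurable (\<nu> \<Otimes>\<^sub>M N)"
        unfolding case_prod_beta' by measurable
      have "(\<integral>\<xi>. norm (?G u \<xi>) \<partial>N) = (\<integral>\<xi>. cmod (h u) * m \<xi> \<partial>N)" for u
        by (rule Bochner_Integration.integral_cong)
           (auto simp: norm_mult space_N char_norm[OF Omega_subset] m_nonneg)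
      then show "integrable \<nu> (\<lambda>u. \<integral>\<xi>. norm (case (u, \<xi>) of (u, \<xi>) \<Rightarrow> ?G u \<xi>) \<partial>N)"
        using h(1) by simp
      show "AE u in \<nu>. integrable N (\<lambda>\<xi>. case (u, \<xi>) of (u, \<xi>) \<Rightarrow> ?G u \<xi>)"
      proof (rule AE_I2)
        fix u
        have "integrable N (\<lambda>\<xi>. cnj (\<xi> u) * complex_of_real (m \<xi>))"
          by (rule Bochner_Integration.integrable_bound[OF m_int])
             (measurable, rule AE_N_I, simp add: norm_mult char_norm[OF Omega_subset])
        then show "integrable N (\<lambda>\<xi>. case (u, \<xi>) of (u, \<xi>) \<Rightarrow> ?G u \<xi>)" by simp
      qed
    qed
    \<comment> \<open>Writing \<open>w\<close> as the Fourier integral of \<open>h\<close> and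
      exchanging the integrals rebuilds \<open>cnj (k u)\<close> from \<open>k_eq\<close>;
      Plancherel then leads back to the dual group.\<close>
    have "(\<integral>\<xi>. complex_of_real (w \<xi> * m \<xi>) \<partial>N) = (\<integral>\<xi>. \<integral>u. ?G u \<xi> \<partial>\<nu> \<partial>N)"
    proof (rule Bochner_Integration.integral_cong[OF refl])
      fix \<xi> assume "\<xi> \<in> space N"
      then have \<xi>: "\<xi> \<in> dual_chars" by (simp add: space_N Omega_subset)
      have "(\<integral>u. ?G u \<xi> \<partial>\<nu>) = (\<integral>u. (h u * cnj (\<xi> u)) * complex_of_real (m \<xi>) \<partial>\<nu>)"
        by (simp add: mult.assoc)
      also have "\<dots> = fourier \<nu> h \<xi> * complex_of_real (m \<xi>)"
        by (simp only: integral_mult_left_zero fourier_def)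
      finally show "complex_of_real (w \<xi> * m \<xi>) = (\<integral>u. ?G u \<xi> \<partial>\<nu>)" by (simp add: h(3)[OF \<xi>])
    qed
    also have "\<dots> = (\<integral>u. \<integral>\<xi>. ?G u \<xi> \<partial>N \<partial>\<nu>)"
      by (rule GN.Fubini_integral[OF G_int])
    also have "\<dots> = (\<integral>u. h u * cnj (k u) \<partial>\<nu>)"
    proof (rule Bochner_Integration.integral_cong[OF refl])
      fix u
      have "cnj (k u) = (\<integral>\<xi>. cnj (\<xi> u * complex_of_real (m \<xi>)) \<partial>N)"
        unfolding k_eq by (rule Bochner_Integration.integral_cnj[symmetric])
      then show "(\<integral>\<xi>. ?G u \<xi> \<partial>N) = h u * cnj (k u)" by simp
    qed
    also have "\<dots> = (\<integral>\<xi>. fourier \<nu> h \<xi> * cnj (fourier \<nu> k \<xi>) \<partial>\<nu>h)"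
      by (rule plancherel_inner[OF h(1,2) k_int k_sq, symmetric])
    finally have eq: "complex_of_real (\<integral>\<xi>. w \<xi> * m \<xi> \<partial>N) = (\<integral>\<xi>. fourier \<nu> h \<xi> * cnj (fourier \<nu> k \<xi>) \<partial>\<nu>h)"
      by (simp only: integral_complex_of_real)
    have prod_int: "integrable \<nu>h (\<lambda>\<xi>. fourier \<nu> h \<xi> * cnj (fourier \<nu> k \<xi>))"
      by (intro square_integrable_mult_integrable plancherel h k_int k_sq)
    have "(\<integral>\<xi>. w \<xi> * m \<xi> \<partial>N) = Re (\<integral>\<xi>. fourier \<nu> h \<xi> * cnj (fourier \<nu> k \<xi>) \<partial>\<nu>h)"
      using eq by (metis Re_complex_of_real)
    also have "\<dots> = (\<integral>\<xi>. Re (fourier \<nu> h \<xi> * cnj (fourier \<nu> k \<xi>)) \<partial>\<nu>h)"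
      by (rule integral_bounded_linear[OF bounded_linear_Re prod_int, symmetric])
    \<comment> \<open>On \<open>\<Omega>\<close> the two integrands agree; off it the left one is
      nonpositive because \<open>w\<close> is nonnegative.\<close>
    also have "\<dots> \<le> (\<integral>\<xi>. indicator \<Omega> \<xi> *\<^sub>R (w \<xi> * (cmod (q \<xi> y))\<^sup>2) \<partial>\<nu>h)"
    proof (rule integral_mono)
      show "integrable \<nu>h (\<lambda>\<xi>. Re (fourier \<nu> h \<xi> * cnj (fourier \<nu> k \<xi>)))"
        by (rule integrable_bounded_linear[OF bounded_linear_Re prod_int])
      show "integrable \<nu>h (\<lambda>\<xi>. indicator \<Omega> \<xi> *\<^sub>R (w \<xi> * (cmod (q \<xi> y))\<^sup>2))"
        using w_int[OF q_int] by (subst (asm) integrable_restrict_space) auto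
      fix \<xi> assume "\<xi> \<in> space \<nu>h"
      then have \<xi>: "\<xi> \<in> dual_chars" by (simp add: space_dual)
      have Re: "Re (fourier \<nu> h \<xi> * cnj (fourier \<nu> k \<xi>)) = w \<xi> * Re (Lker \<nu> K \<xi> y y)"
        unfolding h(3)[OF \<xi>] Fk by simp
      show "Re (fourier \<nu> h \<xi> * cnj (fourier \<nu> k \<xi>)) \<le> indicator \<Omega> \<xi> *\<^sub>R (w \<xi> * (cmod (q \<xi> y))\<^sup>2)"
      proof (cases "\<xi> \<in> \<Omega>")
        case True
        have "Lker \<nu> K \<xi> y y = complex_of_real ((cmod (q \<xi> y))\<^sup>2)"
          unfolding q_fact[OF True] complex_norm_square by (simp add: mult.commute)
        then show ?thesis unfolding Re using True by simp
      next
        case False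
        then have "Re (Lker \<nu> K \<xi> y y) \<le> 0"
          using \<xi> Lker_diag_real[OF \<xi>, of y] by (auto simp: Omega_def not_less)
        then show ?thesis unfolding Re using False w_nonneg[of \<xi>] by (simp add: mult_nonneg_nonpos)
      qed
    qed
    also have "\<dots> = (\<integral>\<xi>. w \<xi> * (cmod (q \<xi> y))\<^sup>2 \<partial>N)"
      by (rule integral_restrict_space[symmetric]) simp
    finally have le: "(\<integral>\<xi>. w \<xi> * m \<xi> \<partial>N) \<le> (\<integral>\<xi>. w \<xi> * (cmod (q \<xi> y))\<^sup>2 \<partial>N)" .
    \<comment> \<open>The lower bound for \<open>qnorm2\<close> gives the difference a sign, so the
      inequality \<open>le\<close> between integrals forces the integrand to vanish almost
      everywhere.\<close>
    have nonneg: "AE \<xi> in N. 0 \<le> w \<xi> * (m \<xi> - (cmod (q \<xi> y))\<^sup>2)"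
      using qnorm2_ge_1
    proof eventually_elim
      case (elim \<xi>)
      then have "(cmod (q \<xi> y))\<^sup>2 * 1 \<le> (cmod (q \<xi> y))\<^sup>2 * (qnorm2 \<xi>)\<^sup>2"
        by (intro mult_left_mono one_le_power) auto
      then show ?case using w_nonneg[of \<xi>] by (simp add: m_def)
    qed
    have int: "integrable N (\<lambda>\<xi>. w \<xi> * (m \<xi> - (cmod (q \<xi> y))\<^sup>2))"
      by (rule w_int) (use m_int q_int in simp)
    have "(\<integral>\<xi>. w \<xi> * (m \<xi> - (cmod (q \<xi> y))\<^sup>2) \<partial>N) = 0"
    proof (rule antisym)
      show "(\<integral>\<xi>. w \<xi> * (m \<xi> - (cmod (q \<xi> y))\<^sup>2) \<partial>N) \<le> 0"
        using le w_int[OF m_int] w_int[OF q_int] by (simp add: right_diff_distrib)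
      show "0 \<le> (\<integral>\<xi>. w \<xi> * (m \<xi> - (cmod (q \<xi> y))\<^sup>2) \<partial>N)" by (rule integral_nonneg_AE[OF nonneg])
    qed
    then have "AE \<xi> in N. w \<xi> * (m \<xi> - (cmod (q \<xi> y))\<^sup>2) = 0"
      using integral_nonneg_eq_0_iff_AE[OF int nonneg] by simp
    then show ?thesis by (simp add: w_def)
  qed
  then have "AE \<xi> in N. \<forall>j. (cmod (fourier \<nu> (indicator (B j)) \<xi>))\<^sup>2 * (m \<xi> - (cmod (q \<xi> y))\<^sup>2) = 0"
    by (subst AE_all_countable) simp
  then show ?thesis using AE_N_Omega
  proof eventually_elim
    case (elim \<xi>)
    obtain j where "fourier \<nu> (indicator (B j)) \<xi> \<noteq> 0" using B(3) Omega_subset[OF elim(2)] by blast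
    then have "m \<xi> = (cmod (q \<xi> y))\<^sup>2" using elim(1) by auto
    then have "q \<xi> y = 0 \<or> (qnorm2 \<xi>)\<^sup>2 = 1" by (simp add: m_def)
    then show ?case using qnorm2_nonneg[of \<xi>] by (simp add: power2_eq_1_iff)
  qed
qed

text \<open>The null set of the previous lemma depends on y. After Fubini, a \<xi> with norm other
  than 1 would have q_\<xi> = 0 almost everywhere, against the lower bound.\<close>

lemma qnorm2_eq_1: "AE \<xi> in N. qnorm2 \<xi> = 1"
proof -
  have "AE y in lam. AE \<xi> in N. q \<xi> y = 0 \<or> qnorm2 \<xi> = 1"
    using qnorm2_eq_1_if_nonzero by simp
  then have "AE \<xi> in N. AE y in lam. q \<xi> y = 0 \<or> qnorm2 \<xi> = 1"
    by (subst NL.AE_commute) simp_all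
  then show ?thesis using qnorm2_ge_1 AE_N_Omega
  proof eventually_elim
    case (elim \<xi>)
    show ?case
    proof (rule ccontr)
      assume "qnorm2 \<xi> \<noteq> 1"
      then have "AE v in lam. (cmod (q \<xi> v))\<^sup>2 = 0" using elim(1) by simp
      then have "qnorm2 \<xi> = 0" unfolding qnorm2_def using elim(3)
        by (intro integral_eq_zero_AE) auto
      then show False using elim(2) by simp
    qed
  qed
qed

lemma R_K: "AE \<xi> in N. R (K x y) \<xi> = cnj (\<xi> x) * cnj (q \<xi> y)"
  using R_K_qnorm2[of x y] qnorm2_eq_1 by eventually_elim simp

section \<open>The integral formula\<close>

text \<open>The inverse of \<open>R\<close>, valid at every point because elements of
  \<open>H\<close> are genuine functions with the reproducing property. Any measurable
  representative \<open>r\<close> of the image may be inserted.\<close>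

lemma R_inversion:
  assumes g: "g \<in> H" and r: "AE \<xi> in N. R g \<xi> = r \<xi>" and [measurable]: "r \<in> borel_measurable N"
  shows "g (x, y) = (\<integral>\<xi>. r \<xi> * (\<xi> x * q \<xi> y) \<partial>N)"
proof -
  have "g (x, y) = (\<integral>\<xi>. R g \<xi> * cnj (R (K x y) \<xi>) \<partial>N)"
    unfolding R_inner[OF g K_in_H] by (rule reproducing[OF g])
  also have "\<dots> = (\<integral>\<xi>. r \<xi> * (\<xi> x * q \<xi> y) \<partial>N)"
  proof (rule integral_cong_AE)
    note [measurable] = square_integrable_measurable[OF R_square_integrable[OF K_in_H]]
      square_integrable_measurable[OF R_square_integrable[OF g]]
    show "(\<lambda>\<xi>. R g \<xi> * cnj (R (K x y) \<xi>)) \<in> borel_measurable N" by measurable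
    show "(\<lambda>\<xi>. r \<xi> * (\<xi> x * q \<xi> y)) \<in> borel_measurable N" by measurable
    show "AE \<xi> in N. R g \<xi> * cnj (R (K x y) \<xi>) = r \<xi> * (\<xi> x * q \<xi> y)"
      using r R_K[of x y] by eventually_elim simp
  qed
  finally show ?thesis .
qed

lemma square_integrable_bounded_mult:
  assumes "essentially_bounded N b" "square_integrable N r"
  shows "square_integrable N (\<lambda>\<xi>. b \<xi> * r \<xi>)"
proof -
  obtain C where C: "AE \<xi> in N. cmod (b \<xi>) \<le> C" and [measurable]: "b \<in> borel_measurable N"
    using assms(1) unfolding essentially_bounded_def by blast
  note [measurable] = square_integrable_measurable[OF assms(2)]
  show ?thesis
  proof (rule square_integrable_bound[OF assms(2)])
    show "AE \<xi> in N. cmod (b \<xi> * r \<xi>) \<le> C * cmod (r \<xi>)"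
      using C by eventually_elim (simp add: norm_mult mult_right_mono)
  qed measurable
qed

lemma Vop_formula:
  assumes b: "essentially_bounded N b" and f: "f \<in> H"
  shows "Vop \<nu> \<nu>h lam H K q b f (x, y)
           = (\<integral>p. f p * phi \<nu> \<nu>h K b (x - fst p) y (snd p) \<partial>(\<nu> \<Otimes>\<^sub>M lam))"
proof -
  have b_meas [measurable]: "b \<in> borel_measurable N" using b unfolding essentially_bounded_def by blast
  note [measurable] = square_integrable_measurable[OF R_square_integrable[OF f]]
  define g where "g = Vop \<nu> \<nu>h lam H K q b f"
  have "\<exists>g. g \<in> H \<and> (AE \<xi> in N. R g \<xi> = b \<xi> * R f \<xi>)"
    using R_onto[OF square_integrable_bounded_mult[OF b R_square_integrable[OF f]]] by blast
  \<comment> \<open>The element picked by \<open>SOME\<close> need not be identified further, since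
    \<open>R_inversion\<close> recovers its values from its image under \<open>R\<close>.\<close>
  then have g: "g \<in> H" "AE \<xi> in N. R g \<xi> = b \<xi> * R f \<xi>"
    unfolding g_def Vop_def by (rule someI2_ex, blast)+
  define r where "r \<xi> = cnj (b \<xi> * (\<xi> x * q \<xi> y))" for \<xi>
  have r_meas [measurable]: "r \<in> borel_measurable N" unfolding r_def by measurable
  \<comment> \<open>This function is almost everywhere the conjugate of R applied to
    \<open>K x y\<close>.\<close>
  have "square_integrable N (\<lambda>\<xi>. \<xi> x * q \<xi> y)"
  proof (rule square_integrable_bound[OF R_square_integrable[OF K_in_H[of x y]]])
    show "(\<lambda>\<xi>. \<xi> x * q \<xi> y) \<in> borel_measurable N" by measurable
    show "AE \<xi> in N. cmod (\<xi> x * q \<xi> y) \<le> 1 * cmod (R (K x y) \<xi>)"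
      using R_K[of x y] by eventually_elim (simp add: norm_mult)
  qed
  then have "square_integrable N r"
    unfolding r_def by (intro square_integrable_cnj square_integrable_bounded_mult[OF b])
  then obtain h where h: "h \<in> H" "AE \<xi> in N. R h \<xi> = r \<xi>" using R_onto by blast
  \<comment> \<open>Conjugating the inversion formula for \<open>h\<close> pairs \<xi>(x) with the
    conjugate of \<xi>(u), giving \<xi>(x - u), and q_\<xi>(y) with the conjugate of q_\<xi>(v),
    giving \<open>Lker \<nu> K \<xi> v y\<close>.\<close>
  have phi_eq: "phi \<nu> \<nu>h K b (x - u) y v = cnj (h (u, v))" for u v
  proof -
    have "cnj (h (u, v)) = (\<integral>\<xi>. cnj (r \<xi> * (\<xi> u * q \<xi> v)) \<partial>N)"
      unfolding R_inversion[OF h r_meas] by (rule Bochner_Integration.integral_cnj[symmetric])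
    also have "\<dots> = phi \<nu> \<nu>h K b (x - u) y v"
      unfolding phi_def
      by (intro Bochner_Integration.integral_cong)
         (auto simp: r_def space_N q_fact char_diff[OF Omega_subset] mult_ac)
    finally show ?thesis ..
  qed
  have "g (x, y) = (\<integral>\<xi>. (b \<xi> * R f \<xi>) * (\<xi> x * q \<xi> y) \<partial>N)"
    by (rule R_inversion[OF g]) measurable
  also have "\<dots> = (\<integral>\<xi>. R f \<xi> * cnj (R h \<xi>) \<partial>N)"
  proof (rule integral_cong_AE)
    note [measurable] = square_integrable_measurable[OF R_square_integrable[OF h(1)]]
    show "(\<lambda>\<xi>. (b \<xi> * R f \<xi>) * (\<xi> x * q \<xi> y)) \<in> borel_measurable N" by measurable
    show "(\<lambda>\<xi>. R f \<xi> * cnj (R h \<xi>)) \<in> borel_measurable N" by measurable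
    show "AE \<xi> in N. (b \<xi> * R f \<xi>) * (\<xi> x * q \<xi> y) = R f \<xi> * cnj (R h \<xi>)"
      using h(2) by eventually_elim (simp add: r_def mult_ac)
  qed
  also have "\<dots> = (\<integral>p. f p * cnj (h p) \<partial>(\<nu> \<Otimes>\<^sub>M lam))" by (rule R_inner[OF f h(1)])
  also have "\<dots> = (\<integral>p. f p * phi \<nu> \<nu>h K b (x - fst p) y (snd p) \<partial>(\<nu> \<Otimes>\<^sub>M lam))"
    by (simp add: phi_eq)
  finally show ?thesis unfolding g_def .
qed

end

theorem theorem4p5:
  fixes \<nu> :: "'g::{ab_group_add, metric_space} measure"
    and \<nu>h :: "('g \<Rightarrow> complex) measure"
    and lam :: "'y measure"
    and H :: "('g \<times> 'y \<Rightarrow> complex) set"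
    and K :: "'g \<Rightarrow> 'y \<Rightarrow> 'g \<times> 'y \<Rightarrow> complex"
    and q :: "('g \<Rightarrow> complex) \<Rightarrow> 'y \<Rightarrow> complex"
    and b :: "('g \<Rightarrow> complex) \<Rightarrow> complex"
    and f :: "'g \<times> 'y \<Rightarrow> complex"
    and x :: 'g and y :: 'y
  assumes G: "lca_metrizable_sigma_compact TYPE('g)"
    and haar: "haar_on euclidean (+) \<nu>"
    and Y: "sigma_finite_measure lam" "space lam = UNIV"
    and sepG: "L2_separable \<nu>" and sepY: "L2_separable lam"
    and haar_dual: "haar_on dual_topology dual_mult \<nu>h"
    and planch: "plancherel_normalized \<nu> \<nu>h"
    and rkhs: "rkhs_L2 \<nu> lam H K"
    and transl: "\<And>x y u v. K x y (u, v) = K 0 y (u - x, v)"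
    and Kbound: "\<And>y. \<exists>C::real. \<forall>v. (\<integral>\<^sup>+ u. ennreal (cmod (K 0 y (u, v))) \<partial>\<nu>) \<le> ennreal C"
    and q_meas: "(\<lambda>(\<xi>, v). q \<xi> v) \<in> borel_measurable (restrict_space \<nu>h (Omega \<nu> K) \<Otimes>\<^sub>M lam)"
    and q_fact: "\<And>\<xi> y v. \<xi> \<in> Omega \<nu> K \<Longrightarrow> Lker \<nu> K \<xi> y v = cnj (q \<xi> y) * q \<xi> v"
    and R_isometric: "\<And>g. g \<in> H \<Longrightarrow>
          square_integrable (restrict_space \<nu>h (Omega \<nu> K)) (Rop \<nu> \<nu>h lam q g) \<and>
          (\<integral>\<xi>. (cmod (Rop \<nu> \<nu>h lam q g \<xi>))\<^sup>2 \<partial>(restrict_space \<nu>h (Omega \<nu> K)))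
            = (\<integral>p. (cmod (g p))\<^sup>2 \<partial>(\<nu> \<Otimes>\<^sub>M lam))"
    and R_onto: "\<And>r. square_integrable (restrict_space \<nu>h (Omega \<nu> K)) r \<Longrightarrow>
          \<exists>g\<in>H. AE \<xi> in restrict_space \<nu>h (Omega \<nu> K). Rop \<nu> \<nu>h lam q g \<xi> = r \<xi>"
    and b: "essentially_bounded (restrict_space \<nu>h (Omega \<nu> K)) b"
    and f: "f \<in> H"
  shows "Vop \<nu> \<nu>h lam H K q b f (x, y)
           = (\<integral>p. f p * phi \<nu> \<nu>h K b (x - fst p) y (snd p) \<partial>(\<nu> \<Otimes>\<^sub>M lam))"
proof -
  interpret rkhs_setting \<nu> \<nu>h lam H K q
    by (intro rkhs_setting.intro plancherel_product.intro plancherel_pair.intro lca_haar.intro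
          plancherel_pair_axioms.intro plancherel_product_axioms.intro rkhs_setting_axioms.intro)
       (fact G haar haar_dual planch Y rkhs transl Kbound q_meas q_fact R_isometric R_onto)+
  show ?thesis by (rule Vop_formula[OF b f])
qed

end
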